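(* Let $G$ be a finite group with two character degrees, and let $m$ be the degree of any (hence every) non-linear irreducible character of $G$. Then $$\mathrm{AM}_{\mathrm Z}(G) = 1 + 2(m^2-1)\left(1 - \frac{1}{|G|\,|G'|}\sum_{C\in \mathrm{Conj}(G)} |C|^2\right).$$
   Context: All characters are complex characters. For a finite group $G$: $\mathrm{Irr}(G)$ is the set of irreducible characters of $G$, $d_\chi$ is the degree of $\chi$, $\mathrm{Conj}(G)$ is the set of conjugacy classes of $G$, $\chi(C)$ is the common value of $\chi$ on the elements of a conjugacy class $C$, and $G'$ is the derived (commutator) subgroup of $G$. A character is linear if it has degree $1$, and non-linear otherwise. A finite group $G$ has two character degrees if $G$ is non-abelian and all non-linear irreducible characters of $G$ have the same degree. The ZL-amenability constant of a finite group $G$ (the amenability constant of the centre of $\ell^1(G)$) is $$\mathrm{AM}_{\mathrm Z}(G) = \frac{1}{|G|^2}\sum_{C,D\in \mathrm{Conj}(G)} \left| \sum_{\chi\in \mathrm{Irr}(G)} d_\chi^2\, \chi(C)\overline{\chi(D)} \right| \, |C|\,|D|.$$ *)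

theory Defs
  imports
    "HOL-Algebra.Group_Action"
    "HOL-Algebra.Generated_Groups"
    "Jordan_Normal_Form.VS_Connect"
begin

definition GL :: "nat \<Rightarrow> complex mat monoid" where
  "GL n = units_of (ring_mat TYPE(complex) n ())"

definition representation :: "('a, 'b) monoid_scheme \<Rightarrow> nat \<Rightarrow> ('a \<Rightarrow> complex mat) \<Rightarrow> bool" where
  "representation G n \<rho> \<longleftrightarrow> \<rho> \<in> hom G (GL n)"

definition invariant_subspace ::
    "('a, 'b) monoid_scheme \<Rightarrow> nat \<Rightarrow> ('a \<Rightarrow> complex mat) \<Rightarrow> complex vec set \<Rightarrow> bool" where
  "invariant_subspace G n \<rho> W \<longleftrightarrow>
     subspace class_ring W (module_vec TYPE(complex) n) \<and>
     (\<forall>g\<in>carrier G. \<forall>w\<in>W. \<rho> g *\<^sub>v w \<in> W)"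

definition irreducible_representation ::
    "('a, 'b) monoid_scheme \<Rightarrow> nat \<Rightarrow> ('a \<Rightarrow> complex mat) \<Rightarrow> bool" where
  "irreducible_representation G n \<rho> \<longleftrightarrow>
     representation G n \<rho> \<and> n > 0 \<and>
     (\<forall>W. invariant_subspace G n \<rho> W \<longrightarrow> W = {0\<^sub>v n} \<or> W = carrier_vec n)"

definition mat_trace :: "complex mat \<Rightarrow> complex" where
  "mat_trace A = (\<Sum>i<dim_row A. A $$ (i, i))"

text \<open>Characters are restricted to the carrier, so that two characters are equal as
  HOL functions iff they agree on the group; otherwise one irreducible character would
  occur many times in \<open>Irr G\<close>.\<close>

definition character_of :: "('a, 'b) monoid_scheme \<Rightarrow> ('a \<Rightarrow> complex mat) \<Rightarrow> 'a \<Rightarrow> complex" where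
  "character_of G \<rho> = (\<lambda>g\<in>carrier G. mat_trace (\<rho> g))"

definition Irr :: "('a, 'b) monoid_scheme \<Rightarrow> ('a \<Rightarrow> complex) set" where
  "Irr G = {character_of G \<rho> | n \<rho>. irreducible_representation G n \<rho>}"

text \<open>The degree is the dimension of any representation affording the character; see
  \<open>char_degree_eq\<close> for uniqueness.\<close>

definition char_degree :: "('a, 'b) monoid_scheme \<Rightarrow> ('a \<Rightarrow> complex) \<Rightarrow> nat" where
  "char_degree G \<chi> = (THE n. \<exists>\<rho>. representation G n \<rho> \<and> \<chi> = character_of G \<rho>)"

definition linear_character :: "('a, 'b) monoid_scheme \<Rightarrow> ('a \<Rightarrow> complex) \<Rightarrow> bool" where
  "linear_character G \<chi> \<longleftrightarrow> char_degree G \<chi> = 1"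

definition two_character_degrees :: "('a, 'b) monoid_scheme \<Rightarrow> bool" where
  "two_character_degrees G \<longleftrightarrow>
     \<not> comm_group G \<and>
     (\<forall>\<chi>\<in>Irr G. \<forall>\<psi>\<in>Irr G. \<not> linear_character G \<chi> \<longrightarrow> \<not> linear_character G \<psi> \<longrightarrow>
        char_degree G \<chi> = char_degree G \<psi>)"

text \<open>The action is written exactly as in the library theorem \<open>group.action_by_conjugation\<close>.\<close>

definition conj_classes :: "('a, 'b) monoid_scheme \<Rightarrow> 'a set set" where
  "conj_classes G =
     orbits G (carrier G) (\<lambda>g. \<lambda>h\<in>carrier G. g \<otimes>\<^bsub>G\<^esub> h \<otimes>\<^bsub>G\<^esub> inv\<^bsub>G\<^esub> g)"

text \<open>The common value of \<open>\<chi>\<close> on \<open>C\<close>; \<open>class_value_eq\<close> shows that it is well defined.\<close>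

definition class_value :: "('a \<Rightarrow> complex) \<Rightarrow> 'a set \<Rightarrow> complex" where
  "class_value \<chi> C = the_elem (\<chi> ` C)"

definition AM_Z :: "('a, 'b) monoid_scheme \<Rightarrow> real" where
  "AM_Z G = 1 / (real (card (carrier G)))\<^sup>2 *
     (\<Sum>C\<in>conj_classes G. \<Sum>D\<in>conj_classes G.
        cmod (\<Sum>\<chi>\<in>Irr G. (of_nat (char_degree G \<chi>))\<^sup>2 * class_value \<chi> C * cnj (class_value \<chi> D))
        * real (card C) * real (card D))"

lemma representation_carrier:
  assumes "representation G n \<rho>" "g \<in> carrier G"
  shows "\<rho> g \<in> carrier_mat n n"
  using assms by (auto simp: representation_def GL_def hom_def units_of_def Units_def ring_mat_simps)

lemma representation_mult:
  assumes "representation G n \<rho>" "g \<in> carrier G" "h \<in> carrier G"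
  shows "\<rho> (g \<otimes>\<^bsub>G\<^esub> h) = \<rho> g * \<rho> h"
  using assms by (auto simp: representation_def GL_def hom_def units_of_def ring_mat_simps)

lemma representation_one:
  assumes G: "group G" and \<rho>: "representation G n \<rho>"
  shows "\<rho> \<one>\<^bsub>G\<^esub> = 1\<^sub>m n"
proof -
  interpret R: ring "ring_mat TYPE(complex) n ()" by (rule ring_mat)
  have "group (GL n)" unfolding GL_def by (rule R.units_group)
  then have "\<rho> \<one>\<^bsub>G\<^esub> = \<one>\<^bsub>GL n\<^esub>"
    using \<rho> G hom_one unfolding representation_def by blast
  then show ?thesis by (simp add: GL_def units_of_def ring_mat_simps)
qed

lemma char_degree_eq:
  assumes G: "group G" and \<rho>: "representation G n \<rho>"
  shows "char_degree G (character_of G \<rho>) = n"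
    and "character_of G \<rho> \<one>\<^bsub>G\<^esub> = of_nat n"
proof -
  interpret group G by fact
  have *: "character_of G \<sigma> \<one>\<^bsub>G\<^esub> = of_nat k" if "representation G k \<sigma>" for k \<sigma>
    using representation_one[OF G that] by (simp add: character_of_def mat_trace_def)
  show "character_of G \<rho> \<one>\<^bsub>G\<^esub> = of_nat n" using * \<rho> .
  show "char_degree G (character_of G \<rho>) = n"
    unfolding char_degree_def
    by (rule the_equality) (use \<rho> * in \<open>auto, metis of_nat_eq_iff\<close>)
qed

lemma mat_trace_comm:
  assumes "A \<in> carrier_mat n n" "B \<in> carrier_mat n n"
  shows "mat_trace (A * B) = mat_trace (B * A)"
proof -
  have "mat_trace (A * B) = (\<Sum>i<n. \<Sum>j<n. A $$ (i, j) * B $$ (j, i))"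
    using assms by (simp add: mat_trace_def scalar_prod_def atLeast0LessThan)
  also have "\<dots> = (\<Sum>j<n. \<Sum>i<n. A $$ (i, j) * B $$ (j, i))" by (rule sum.swap)
  also have "\<dots> = mat_trace (B * A)"
    using assms by (simp add: mat_trace_def scalar_prod_def atLeast0LessThan mult.commute)
  finally show ?thesis .
qed

lemma character_of_conj:
  assumes G: "group G" and \<rho>: "representation G n \<rho>" and gx: "g \<in> carrier G" "x \<in> carrier G"
  shows "character_of G \<rho> (g \<otimes>\<^bsub>G\<^esub> x \<otimes>\<^bsub>G\<^esub> inv\<^bsub>G\<^esub> g) = character_of G \<rho> x"
proof -
  interpret group G by fact
  note c = representation_carrier[OF \<rho>]
  have "mat_trace (\<rho> (g \<otimes>\<^bsub>G\<^esub> x \<otimes>\<^bsub>G\<^esub> inv\<^bsub>G\<^esub> g)) = mat_trace (\<rho> (g \<otimes>\<^bsub>G\<^esub> x) * \<rho> (inv\<^bsub>G\<^esub> g))"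
    using gx by (simp add: representation_mult[OF \<rho>])
  also have "\<dots> = mat_trace (\<rho> (inv\<^bsub>G\<^esub> g) * \<rho> (g \<otimes>\<^bsub>G\<^esub> x))"
    by (rule mat_trace_comm[of _ n]) (use gx c in auto)
  also have "\<dots> = mat_trace (\<rho> (inv\<^bsub>G\<^esub> g \<otimes>\<^bsub>G\<^esub> (g \<otimes>\<^bsub>G\<^esub> x)))"
    using gx by (simp add: representation_mult[OF \<rho>])
  also have "inv\<^bsub>G\<^esub> g \<otimes>\<^bsub>G\<^esub> (g \<otimes>\<^bsub>G\<^esub> x) = x"
    using gx by (simp add: m_assoc[symmetric])
  finally show ?thesis using gx by (simp add: character_of_def)
qed

lemma class_value_eq:
  assumes G: "group G" and \<chi>: "\<chi> \<in> Irr G" and C: "C \<in> conj_classes G" and x: "x \<in> C"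
  shows "class_value \<chi> C = \<chi> x"
proof -
  obtain n \<rho> where \<rho>: "representation G n \<rho>" and \<chi>: "\<chi> = character_of G \<rho>"
    using \<chi> unfolding Irr_def irreducible_representation_def by auto
  obtain y where y: "y \<in> carrier G"
    and C: "C = {g \<otimes>\<^bsub>G\<^esub> y \<otimes>\<^bsub>G\<^esub> inv\<^bsub>G\<^esub> g | g. g \<in> carrier G}"
    using C unfolding conj_classes_def orbits_def orbit_def by auto
  have "\<chi> z = \<chi> y" if "z \<in> C" for z
    using that y character_of_conj[OF G \<rho>] unfolding C \<chi> by auto
  then have "\<chi> ` C = {\<chi> x}" using x by auto
  then show ?thesis by (simp add: class_value_def)
qed

end

theory Submission
  imports Defs "Jordan_Normal_Form.Spectral_Radius" "HOL-Library.Multiset"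
begin

text \<open>The weight \<open>d\<^sup>2\<close> takes only the values \<open>1\<close> and \<open>m\<^sup>2\<close>, so the inner sum of \<open>AM_Z\<close> is \<open>m\<^sup>2\<close> times
  the full column sum minus \<open>m\<^sup>2 - 1\<close> times the column sum over linear characters. Column
  orthogonality evaluates the first one; the second one is column orthogonality in the
  abelianisation \<open>G/G'\<close>, whose irreducible characters inflate to the linear characters of \<open>G\<close>.

  Column orthogonality itself comes from the regular character \<open>r\<close>, in which each irreducible
  character \<open>\<chi>\<close> has multiplicity \<open>\<chi>(1)\<close>: by Schur's lemma \<open>\<Sum>\<^sub>g \<chi>(x g y g\<^sup>-\<^sup>1) = |G| \<chi>(x) \<chi>(y) / \<chi>(1)\<close>,
  and summing \<open>r(x g y\<^sup>-\<^sup>1 g\<^sup>-\<^sup>1)\<close> over \<open>g\<close> counts the elements conjugating \<open>y\<close> to \<open>x\<close>. Since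
  only characters matter, composition series (block triangular form) suffice to decompose \<open>r\<close>
  and Maschke's theorem is not needed.\<close>

section \<open>Schur's lemma\<close>

lemma subspace_vecI:
  fixes W :: "complex vec set"
  assumes "W \<subseteq> carrier_vec n" "0\<^sub>v n \<in> W"
    and "\<And>v w. v \<in> W \<Longrightarrow> w \<in> W \<Longrightarrow> v + w \<in> W" "\<And>c v. v \<in> W \<Longrightarrow> c \<cdot>\<^sub>v v \<in> W"
  shows "VectorSpace.subspace class_ring W (module_vec TYPE(complex) n)"
  using assms vec_vs[of n, where 'a=complex] vec_module[of n, where 'a=complex]
  by (intro VectorSpace.subspace.intro LinearCombinations.submodule.intro) (auto simp: module_vec_simps)

lemma irreducible_cases:
  assumes "irreducible_representation G n \<rho>" "W \<subseteq> carrier_vec n" "0\<^sub>v n \<in> W"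
    and "\<And>v w. v \<in> W \<Longrightarrow> w \<in> W \<Longrightarrow> v + w \<in> W" "\<And>c v. v \<in> W \<Longrightarrow> c \<cdot>\<^sub>v v \<in> W"
    and "\<And>g w. g \<in> carrier G \<Longrightarrow> w \<in> W \<Longrightarrow> \<rho> g *\<^sub>v w \<in> W"
  shows "W = {0\<^sub>v n} \<or> W = carrier_vec n"
proof -
  have "invariant_subspace G n \<rho> W"
    unfolding invariant_subspace_def using assms subspace_vecI[of W n] by blast
  then show ?thesis using assms(1) unfolding irreducible_representation_def by blast
qed

lemma mat_eq_of_mult_vec:
  fixes A B :: "'a :: semiring_1 mat"
  assumes A: "A \<in> carrier_mat n k" and B: "B \<in> carrier_mat n k"
    and eq: "\<And>v. v \<in> carrier_vec k \<Longrightarrow> A *\<^sub>v v = B *\<^sub>v v"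
  shows "A = B"
proof (rule eq_matI)
  fix i j assume ij: "i < dim_row B" "j < dim_col B"
  have "(A *\<^sub>v unit_vec k j) $ i = (B *\<^sub>v unit_vec k j) $ i" by (simp add: eq)
  then show "A $$ (i, j) = B $$ (i, j)"
    using A B ij by (simp add: scalar_prod_right_unit)
qed (use A B in auto)

lemma mult_mat_zero_vec:
  fixes A :: "'a :: semiring_0 mat"
  assumes "A \<in> carrier_mat n k"
  shows "A *\<^sub>v 0\<^sub>v k = 0\<^sub>v n"
  using assms by (intro eq_vecI) (auto simp: scalar_prod_def)

text \<open>Kernel and image of \<open>T\<close> are invariant subspaces. Since \<open>T\<close> is
  nonzero, the kernel is not everything and the image is not zero, so irreducibility of
  \<open>\<sigma>\<close> and of \<open>\<rho>\<close> makes \<open>T\<close> bijective.\<close>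

lemma schur_inverse:
  assumes \<rho>: "irreducible_representation G n \<rho>" and \<sigma>: "irreducible_representation G k \<sigma>"
    and T: "T \<in> carrier_mat n k" and T0: "T \<noteq> 0\<^sub>m n k"
    and inter: "\<And>g. g \<in> carrier G \<Longrightarrow> \<rho> g * T = T * \<sigma> g"
  obtains S where "S \<in> carrier_mat k n" "T * S = 1\<^sub>m n" "S * T = 1\<^sub>m k"
proof -
  have rr: "representation G n \<rho>" "representation G k \<sigma>"
    using \<rho> \<sigma> by (auto simp: irreducible_representation_def)
  note c = representation_carrier[OF rr(1)] representation_carrier[OF rr(2)]
  define K where "K = {v \<in> carrier_vec k. T *\<^sub>v v = 0\<^sub>v n}"
  define I where "I = {T *\<^sub>v v | v. v \<in> carrier_vec k}"
  have act: "\<rho> g *\<^sub>v (T *\<^sub>v v) = T *\<^sub>v (\<sigma> g *\<^sub>v v)" if "g \<in> carrier G" "v \<in> carrier_vec k" for g v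
    using inter[OF that(1)] assoc_mult_mat_vec[OF c(1)[OF that(1)] T that(2)]
      assoc_mult_mat_vec[OF T c(2)[OF that(1)] that(2)] by simp
  have "K = {0\<^sub>v k} \<or> K = carrier_vec k"
  proof (rule irreducible_cases[OF \<sigma>])
    fix g w assume g: "g \<in> carrier G" and w: "w \<in> K"
    have "T *\<^sub>v (\<sigma> g *\<^sub>v w) = \<rho> g *\<^sub>v 0\<^sub>v n" using act[OF g, of w] w by (simp add: K_def)
    also have "\<dots> = 0\<^sub>v n" using c(1)[OF g] by (rule mult_mat_zero_vec)
    finally show "\<sigma> g *\<^sub>v w \<in> K" using c(2)[OF g] w by (auto simp: K_def)
  qed (use T in \<open>auto simp: K_def mult_add_distrib_mat_vec mult_mat_vec mult_mat_zero_vec\<close>)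
  moreover have "K \<noteq> carrier_vec k"
  proof
    assume "K = carrier_vec k"
    have "T = 0\<^sub>m n k"
    proof (rule mat_eq_of_mult_vec[OF T])
      fix v :: "complex vec" assume v: "v \<in> carrier_vec k"
      then have "T *\<^sub>v v = 0\<^sub>v n" using \<open>K = carrier_vec k\<close> unfolding K_def by blast
      moreover have "0\<^sub>m n k *\<^sub>v v = 0\<^sub>v n" using v by (intro eq_vecI) (auto simp: scalar_prod_def)
      ultimately show "T *\<^sub>v v = 0\<^sub>m n k *\<^sub>v v" by simp
    qed simp
    with T0 show False by simp
  qed
  ultimately have K: "K = {0\<^sub>v k}" by simp
  have inj: "v = w" if "v \<in> carrier_vec k" "w \<in> carrier_vec k" "T *\<^sub>v v = T *\<^sub>v w" for v w
  proof -
    have "T *\<^sub>v (v - w) = 0\<^sub>v n" using that T by (simp add: mult_minus_distrib_mat_vec)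
    then have "v - w \<in> K" using that by (simp add: K_def)
    then have d: "v - w = 0\<^sub>v k" using K by simp
    show ?thesis
    proof (rule eq_vecI)
      fix i assume i: "i < dim_vec w"
      have "(v - w) $ i = 0" using d i that by simp
      then show "v $ i = w $ i" using i that by simp
    qed (use that in auto)
  qed
  have "I = {0\<^sub>v n} \<or> I = carrier_vec n"
  proof (rule irreducible_cases[OF \<rho>])
    show "I \<subseteq> carrier_vec n" using T by (auto simp: I_def)
    show "0\<^sub>v n \<in> I" unfolding I_def using T
      by (intro CollectI exI[of _ "0\<^sub>v k"]) (auto simp: mult_mat_zero_vec)
    fix v w assume vw: "v \<in> I" "w \<in> I"
    then obtain v' w' where *: "v' \<in> carrier_vec k" "w' \<in> carrier_vec k" "v = T *\<^sub>v v'" "w = T *\<^sub>v w'"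
      by (auto simp: I_def)
    show "v + w \<in> I" unfolding I_def using T *
      by (intro CollectI exI[of _ "v' + w'"]) (auto simp: mult_add_distrib_mat_vec)
  next
    fix a v assume "v \<in> I"
    then obtain v' where *: "v' \<in> carrier_vec k" "v = T *\<^sub>v v'"  by (auto simp: I_def)
    show "a \<cdot>\<^sub>v v \<in> I" unfolding I_def using T *
      by (intro CollectI exI[of _ "a \<cdot>\<^sub>v v'"]) (auto simp: mult_mat_vec)
  next
    fix g v assume g: "g \<in> carrier G" and "v \<in> I"
    then obtain v' where *: "v' \<in> carrier_vec k" "v = T *\<^sub>v v'"  by (auto simp: I_def)
    show "\<rho> g *\<^sub>v v \<in> I" unfolding I_def using act[OF g *(1)] c(2)[OF g] *
      by (intro CollectI exI[of _ "\<sigma> g *\<^sub>v v'"]) auto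
  qed
  moreover have "I \<noteq> {0\<^sub>v n}"
  proof
    assume "I = {0\<^sub>v n}"
    then have "v \<in> K" if "v \<in> carrier_vec k" for v using that by (auto simp: I_def K_def)
    then show False using \<open>K \<noteq> carrier_vec k\<close> by (auto simp: K_def)
  qed
  ultimately have I: "I = carrier_vec n" by simp
  have "\<exists>v\<in>carrier_vec k. T *\<^sub>v v = unit_vec n i" for i
  proof -
    have "unit_vec n i \<in> I" by (simp add: I)
    then show ?thesis unfolding I_def by force
  qed
  then obtain s where s: "\<And>i. s i \<in> carrier_vec k" "\<And>i. T *\<^sub>v s i = unit_vec n i" by metis
  \<comment> \<open>Column \<open>i\<close> of \<open>S\<close> is a chosen preimage of the
    \<open>i\<close>-th unit vector, so \<open>T * S\<close> is the identity by construction; the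
    other inverse law follows from injectivity of \<open>T\<close>.\<close>
  define S where "S = mat_of_cols k (map s [0..<n])"
  have S: "S \<in> carrier_mat k n" unfolding S_def carrier_mat_def by simp
  have TS: "T * S = 1\<^sub>m n"
  proof (rule mat_col_eqI)
    fix j assume "j < dim_col (1\<^sub>m n :: complex mat)"
    then have j: "j < n" by simp
    have "col (T * S) j = T *\<^sub>v col S j" by (rule col_mult2[OF T S j])
    also have "col S j = s j" using j s(1) by (simp add: S_def)
    finally show "col (T * S) j = col (1\<^sub>m n) j" using s j by simp
  qed (use T S in auto)
  have "S * T = 1\<^sub>m k"
  proof (rule mat_eq_of_mult_vec)
    fix v :: "complex vec" assume v: "v \<in> carrier_vec k"
    have Tv: "T *\<^sub>v v \<in> carrier_vec n" using mult_mat_vec_carrier[OF T v] .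
    have ST: "S * T *\<^sub>v v = S *\<^sub>v (T *\<^sub>v v)" by (rule assoc_mult_mat_vec[OF S T v])
    have STv: "S * T *\<^sub>v v \<in> carrier_vec k" unfolding ST by (rule mult_mat_vec_carrier[OF S Tv])
    have "T *\<^sub>v (S * T *\<^sub>v v) = T * S *\<^sub>v (T *\<^sub>v v)"
      unfolding ST by (rule assoc_mult_mat_vec[OF T S Tv, symmetric])
    also have "\<dots> = T *\<^sub>v v" unfolding TS by (rule one_mult_mat_vec[OF Tv])
    finally show "S * T *\<^sub>v v = 1\<^sub>m k *\<^sub>v v" using inj[OF STv v] v by simp
  qed (use S T in \<open>auto intro: mult_carrier_mat\<close>)
  with S TS show ?thesis using that by blast
qed

text \<open>A complex matrix of positive size has an eigenvalue \<open>a\<close>. The shift of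
  \<open>T\<close> by \<open>a\<close> commutes with the representation and kills an eigenvector, so
  it has no inverse and \<open>schur_inverse\<close> forces it to vanish.\<close>

lemma schur_scalar:
  assumes \<rho>: "irreducible_representation G n \<rho>" and T: "T \<in> carrier_mat n n"
    and inter: "\<And>g. g \<in> carrier G \<Longrightarrow> \<rho> g * T = T * \<rho> g"
  shows "\<exists>c. T = c \<cdot>\<^sub>m 1\<^sub>m n"
proof -
  have rr: "representation G n \<rho>" and n: "n > 0"
    using \<rho> by (auto simp: irreducible_representation_def)
  note c = representation_carrier[OF rr]
  obtain a where "eigenvalue T a"
    using spectrum_non_empty[OF T n] by (auto simp: spectrum_def)
  define U where "U = T + (- a) \<cdot>\<^sub>m 1\<^sub>m n"
  have "char_matrix T a = U" using T by (simp add: char_matrix_def U_def)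
  then obtain v where v: "v \<in> carrier_vec n" "v \<noteq> 0\<^sub>v n" "U *\<^sub>v v = 0\<^sub>v n"
    using \<open>eigenvalue T a\<close> eigenvalue_char_matrix[OF T] by metis
  have U: "U \<in> carrier_mat n n" by (simp add: U_def)
  have "U = 0\<^sub>m n n"
  proof (rule ccontr)
    assume "U \<noteq> 0\<^sub>m n n"
    moreover have "\<rho> g * U = U * \<rho> g" if g: "g \<in> carrier G" for g
    proof -
      note d = T c[OF g] one_carrier_mat[of n]
      have "\<rho> g * U = \<rho> g * T + (- a) \<cdot>\<^sub>m \<rho> g"
        using d by (simp add: U_def mult_add_distrib_mat[of _ n n _ n] mult_smult_distrib[of _ n n _ n])
      also have "\<dots> = U * \<rho> g"
        using d inter[OF g]
        by (simp add: U_def add_mult_distrib_mat[of _ n n _ _ n] mult_smult_assoc_mat[of _ n n _ n])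
      finally show ?thesis .
    qed
    ultimately obtain S where S: "S \<in> carrier_mat n n" "S * U = 1\<^sub>m n"
      using schur_inverse[OF \<rho> \<rho> U] by blast
    have "v = S * U *\<^sub>v v" using S v by simp
    also have "\<dots> = S *\<^sub>v (U *\<^sub>v v)" by (rule assoc_mult_mat_vec[OF S(1) U v(1)])
    also have "\<dots> = 0\<^sub>v n" using mult_mat_zero_vec[OF S(1)] v by simp
    finally show False using v by simp
  qed
  have "T = a \<cdot>\<^sub>m 1\<^sub>m n"
  proof (rule eq_matI)
    fix i j assume ij: "i < dim_row (a \<cdot>\<^sub>m 1\<^sub>m n)" "j < dim_col (a \<cdot>\<^sub>m 1\<^sub>m n)"
    have "U $$ (i, j) = 0" using \<open>U = 0\<^sub>m n n\<close> ij by simp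
    then show "T $$ (i, j) = (a \<cdot>\<^sub>m 1\<^sub>m n) $$ (i, j)" using ij T by (simp add: U_def)
  qed (use T in auto)
  then show ?thesis by blast
qed

section \<open>Orthogonality relations for matrix entries and characters\<close>

text \<open>Intertwiners may run between spaces of a priori different dimensions, hence the version
  for rectangular factors.\<close>

lemma mat_trace_comm_rect:
  assumes "A \<in> carrier_mat n k" "B \<in> carrier_mat k n"
  shows "mat_trace (A * B) = mat_trace (B * A)"
proof -
  have "mat_trace (A * B) = (\<Sum>i<n. \<Sum>j<k. A $$ (i, j) * B $$ (j, i))"
    using assms by (simp add: mat_trace_def scalar_prod_def atLeast0LessThan)
  also have "\<dots> = (\<Sum>j<k. \<Sum>i<n. A $$ (i, j) * B $$ (j, i))" by (rule sum.swap)
  also have "\<dots> = mat_trace (B * A)"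
    using assms by (simp add: mat_trace_def scalar_prod_def atLeast0LessThan mult.commute)
  finally show ?thesis .
qed

lemma index_mult_mat_sum:
  assumes "A \<in> carrier_mat n k" "B \<in> carrier_mat k m" "i < n" "j < m"
  shows "(A * B) $$ (i, j) = (\<Sum>p<k. A $$ (i, p) * B $$ (p, j))"
  using assms by (simp add: scalar_prod_def atLeast0LessThan)

lemma representation_index_mult:
  assumes \<rho>: "representation G n \<rho>" and "g \<in> carrier G" "h \<in> carrier G" "i < n" "j < n"
  shows "\<rho> (g \<otimes>\<^bsub>G\<^esub> h) $$ (i, j) = (\<Sum>p<n. \<rho> g $$ (i, p) * \<rho> h $$ (p, j))"
  using assms representation_carrier[OF \<rho>]
  by (simp add: representation_mult[OF \<rho>] index_mult_mat_sum[of _ n n _ n])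

lemma character_of_eq_sum:
  assumes "representation G n \<rho>" "g \<in> carrier G"
  shows "character_of G \<rho> g = (\<Sum>i<n. \<rho> g $$ (i, i))"
  using representation_carrier[OF assms] assms(2) by (simp add: character_of_def mat_trace_def)

text \<open>Membership in \<open>GL n\<close> follows from multiplicativity and the value at the
  identity, because \<open>\<rho> (inv g)\<close> inverts \<open>\<rho> g\<close>.\<close>

lemma (in group) representationI:
  assumes c: "\<And>g. g \<in> carrier G \<Longrightarrow> \<rho> g \<in> carrier_mat n n"
    and m: "\<And>g h. g \<in> carrier G \<Longrightarrow> h \<in> carrier G \<Longrightarrow> \<rho> (g \<otimes> h) = \<rho> g * \<rho> h"
    and o: "\<rho> \<one> = 1\<^sub>m n"
  shows "representation G n \<rho>"
proof -
  have "\<exists>B\<in>carrier_mat n n. B * \<rho> g = 1\<^sub>m n \<and> \<rho> g * B = 1\<^sub>m n" if g: "g \<in> carrier G" for g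
    using m[of g "inv g"] m[of "inv g" g] g o c[of "inv g"] by (intro bexI[of _ "\<rho> (inv g)"]) auto
  then show ?thesis
    using c m by (auto simp: representation_def GL_def hom_def units_of_def Units_def ring_mat_simps)
qed

section \<open>Averaging over a finite group and Schur orthogonality\<close>

locale fin_group = group G for G (structure) +
  assumes finite_carrier: "finite (carrier G)"
begin

lemma sum_mult_left:
  assumes "h \<in> carrier G"
  shows "(\<Sum>g\<in>carrier G. f (h \<otimes> g)) = (\<Sum>g\<in>carrier G. f g)"
  by (rule sum.reindex_bij_witness[of _ "\<lambda>g. inv h \<otimes> g" "\<lambda>g. h \<otimes> g"])
     (use assms in \<open>auto simp: m_assoc[symmetric]\<close>)

text \<open>\<open>T\<close> is the sum of \<open>\<rho>(g) E \<sigma>(g)\<^sup>-\<^sup>1\<close> over the group, where \<open>E\<close> is the matrix unit at \<open>(p, q)\<close>.\<close>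

lemma average_intertwines:
  assumes \<rho>: "representation G n \<rho>" and \<sigma>: "representation G k \<sigma>" and pq: "p < n" "q < k"
    and h: "h \<in> carrier G"
  defines "T \<equiv> mat n k (\<lambda>(i, j). \<Sum>g\<in>carrier G. \<rho> g $$ (i, p) * \<sigma> (inv g) $$ (q, j))"
  shows "\<rho> h * T = T * \<sigma> h"
proof -
  have T: "T \<in> carrier_mat n k" by (simp add: T_def)
  note \<rho>h = representation_carrier[OF \<rho> h] and \<sigma>h = representation_carrier[OF \<sigma> h]
  show ?thesis
  proof (rule eq_matI)
    fix i j assume "i < dim_row (T * \<sigma> h)" "j < dim_col (T * \<sigma> h)"
    then have ij: "i < n" "j < k" using T \<sigma>h by auto
    have "(\<rho> h * T) $$ (i, j) = (\<Sum>r<n. \<rho> h $$ (i, r) * T $$ (r, j))"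
      by (rule index_mult_mat_sum[OF \<rho>h T ij])
    also have "\<dots> = (\<Sum>r<n. \<Sum>g\<in>carrier G. \<rho> h $$ (i, r) * \<rho> g $$ (r, p) * \<sigma> (inv g) $$ (q, j))"
      using ij by (simp add: T_def sum_distrib_left mult.assoc)
    also have "\<dots> = (\<Sum>g\<in>carrier G. \<Sum>r<n. \<rho> h $$ (i, r) * \<rho> g $$ (r, p) * \<sigma> (inv g) $$ (q, j))"
      by (rule sum.swap)
    \<comment> \<open>Writing \<open>inv g\<close> as \<open>inv (h \<otimes> g) \<otimes> h\<close>
      makes the summand a function of \<open>h \<otimes> g\<close>, so that the sum can be
      translated by \<open>h\<close>.\<close>
    also have "\<dots> = (\<Sum>g\<in>carrier G. \<rho> (h \<otimes> g) $$ (i, p) * \<sigma> (inv (h \<otimes> g) \<otimes> h) $$ (q, j))"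
    proof (rule sum.cong)
      fix g assume g: "g \<in> carrier G"
      have "inv (h \<otimes> g) \<otimes> h = inv g" using g h by (simp add: inv_mult_group m_assoc)
      then show "(\<Sum>r<n. \<rho> h $$ (i, r) * \<rho> g $$ (r, p) * \<sigma> (inv g) $$ (q, j))
          = \<rho> (h \<otimes> g) $$ (i, p) * \<sigma> (inv (h \<otimes> g) \<otimes> h) $$ (q, j)"
        by (simp add: representation_index_mult[OF \<rho> h g ij(1) pq(1)] sum_distrib_right)
    qed simp
    also have "\<dots> = (\<Sum>g\<in>carrier G. \<rho> g $$ (i, p) * \<sigma> (inv g \<otimes> h) $$ (q, j))"
      by (rule sum_mult_left[OF h, where f = "\<lambda>g. \<rho> g $$ (i, p) * \<sigma> (inv g \<otimes> h) $$ (q, j)"])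
    also have "\<dots> = (\<Sum>g\<in>carrier G. \<Sum>r<k. \<rho> g $$ (i, p) * \<sigma> (inv g) $$ (q, r) * \<sigma> h $$ (r, j))"
      using h by (intro sum.cong)
        (simp_all add: representation_index_mult[OF \<sigma> _ h pq(2) ij(2)] sum_distrib_left mult.assoc)
    also have "\<dots> = (\<Sum>r<k. \<Sum>g\<in>carrier G. \<rho> g $$ (i, p) * \<sigma> (inv g) $$ (q, r) * \<sigma> h $$ (r, j))"
      by (rule sum.swap)
    also have "\<dots> = (\<Sum>r<k. T $$ (i, r) * \<sigma> h $$ (r, j))"
      using ij by (simp add: T_def sum_distrib_right)
    also have "\<dots> = (T * \<sigma> h) $$ (i, j)"
      by (rule index_mult_mat_sum[OF T \<sigma>h ij, symmetric])
    finally show "(\<rho> h * T) $$ (i, j) = (T * \<sigma> h) $$ (i, j)" .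
  qed (use T \<rho>h \<sigma>h in auto)
qed

text \<open>The averaged matrix unit intertwines the two representations. Were it nonzero, Schur's
  lemma would make them similar and hence equal in trace, against the assumption.\<close>

lemma schur_orthogonality_distinct:
  assumes \<rho>: "irreducible_representation G n \<rho>" and \<sigma>: "irreducible_representation G k \<sigma>"
    and ne: "character_of G \<rho> \<noteq> character_of G \<sigma>"
    and ind: "i < n" "p < n" "q < k" "j < k"
  shows "(\<Sum>g\<in>carrier G. \<rho> g $$ (i, p) * \<sigma> (inv g) $$ (q, j)) = 0"
proof -
  have rr: "representation G n \<rho>" "representation G k \<sigma>"
    using \<rho> \<sigma> by (auto simp: irreducible_representation_def)
  define T where "T = mat n k (\<lambda>(i, j). \<Sum>g\<in>carrier G. \<rho> g $$ (i, p) * \<sigma> (inv g) $$ (q, j))"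
  have T: "T \<in> carrier_mat n k" by (simp add: T_def)
  have inter: "\<rho> h * T = T * \<sigma> h" if "h \<in> carrier G" for h
    unfolding T_def by (rule average_intertwines[OF rr ind(2,3) that])
  have "T = 0\<^sub>m n k"
  proof (rule ccontr)
    assume "T \<noteq> 0\<^sub>m n k"
    then obtain S where S: "S \<in> carrier_mat k n" "T * S = 1\<^sub>m n" "S * T = 1\<^sub>m k"
      using schur_inverse[OF \<rho> \<sigma> T] inter by blast
    have "mat_trace (\<rho> g) = mat_trace (\<sigma> g)" if g: "g \<in> carrier G" for g
    proof -
      note c = representation_carrier[OF rr(1) g] representation_carrier[OF rr(2) g]
      have "\<sigma> g = S * T * \<sigma> g" using left_mult_one_mat[OF c(2)] S(3) by simp
      also have "\<dots> = S * (\<rho> g * T)"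
        unfolding inter[OF g] by (rule assoc_mult_mat[OF S(1) T c(2)])
      finally have "mat_trace (\<sigma> g) = mat_trace (S * (\<rho> g * T))" by simp
      also have "\<dots> = mat_trace (\<rho> g * T * S)"
        by (rule mat_trace_comm_rect[OF S(1) mult_carrier_mat[OF c(1) T]])
      also have "\<rho> g * T * S = \<rho> g * (T * S)" by (rule assoc_mult_mat[OF c(1) T S(1)])
      also have "\<dots> = \<rho> g" unfolding S(2) by (rule right_mult_one_mat[OF c(1)])
      finally show ?thesis by simp
    qed
    then have "character_of G \<rho> = character_of G \<sigma>" by (auto simp: character_of_def)
    with ne show False by simp
  qed
  then have "T $$ (i, j) = 0" using ind by simp
  then show ?thesis using ind by (simp add: T_def)
qed

text \<open>Here the averaged matrix unit is a scalar matrix by Schur's lemma. Its trace is the sum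
  of the \<open>(q, p)\<close> entries of \<open>\<rho> (inv g \<otimes> g)\<close>, that is of
  identity matrices, and this determines the scalar.\<close>

lemma schur_orthogonality_same:
  assumes \<rho>: "irreducible_representation G n \<rho>"
    and ind: "i < n" "p < n" "q < n" "j < n"
  shows "(\<Sum>g\<in>carrier G. \<rho> g $$ (i, p) * \<rho> (inv g) $$ (q, j))
    = (if i = j \<and> p = q then of_nat (card (carrier G)) / of_nat n else 0)"
proof -
  have rr: "representation G n \<rho>"
    using \<rho> by (auto simp: irreducible_representation_def)
  define T where "T = mat n n (\<lambda>(i, j). \<Sum>g\<in>carrier G. \<rho> g $$ (i, p) * \<rho> (inv g) $$ (q, j))"
  have T: "T \<in> carrier_mat n n" by (simp add: T_def)
  have inter: "\<rho> h * T = T * \<rho> h" if "h \<in> carrier G" for h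
    unfolding T_def by (rule average_intertwines[OF rr rr ind(2,3) that])
  obtain c where c: "T = c \<cdot>\<^sub>m 1\<^sub>m n" using schur_scalar[OF \<rho> T inter] by blast
  have "of_nat n * c = (\<Sum>i<n. T $$ (i, i))" by (simp add: c)
  also have "\<dots> = (\<Sum>i<n. \<Sum>g\<in>carrier G. \<rho> g $$ (i, p) * \<rho> (inv g) $$ (q, i))"
    by (simp add: T_def)
  also have "\<dots> = (\<Sum>g\<in>carrier G. \<Sum>i<n. \<rho> g $$ (i, p) * \<rho> (inv g) $$ (q, i))"
    by (rule sum.swap)
  also have "\<dots> = (\<Sum>g\<in>carrier G. \<rho> (inv g \<otimes> g) $$ (q, p))"
    using ind by (intro sum.cong)
      (simp_all only: representation_index_mult[OF rr] inv_closed mult.commute)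
  also have "\<dots> = of_nat (card (carrier G)) * (if p = q then 1 else 0)"
    using ind by (simp add: representation_one[OF group_axioms rr])
  finally have "c = (if p = q then of_nat (card (carrier G)) / of_nat n else 0)"
    using ind by (auto simp: field_simps split: if_splits)
  moreover have "T $$ (i, j) = (if i = j then c else 0)" using ind by (simp add: c)
  ultimately show ?thesis using ind by (auto simp: T_def)
qed

lemma Irr_E:
  assumes "\<chi> \<in> Irr G"
  obtains n \<rho> where "irreducible_representation G n \<rho>" "representation G n \<rho>" "n > 0"
    "\<chi> = character_of G \<rho>" "char_degree G \<chi> = n" "\<chi> \<one> = of_nat n"
proof -
  obtain n \<rho> where *: "irreducible_representation G n \<rho>" "\<chi> = character_of G \<rho>"
    using assms by (auto simp: Irr_def)
  then have "representation G n \<rho>" "n > 0" by (auto simp: irreducible_representation_def)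
  with * char_degree_eq[OF group_axioms] show ?thesis by (intro that) auto
qed

text \<open>\<open>\<psi> (inv g)\<close> stands where the conjugate of \<open>\<psi> g\<close> is
  customary, since this is what the orthogonality of matrix entries yields directly;
  \<open>character_inv\<close> relates the two.\<close>

lemma row_orthogonality:
  assumes "\<chi> \<in> Irr G" "\<psi> \<in> Irr G"
  shows "(\<Sum>g\<in>carrier G. \<chi> g * \<psi> (inv g)) = (if \<chi> = \<psi> then of_nat (card (carrier G)) else 0)"
proof -
  obtain n \<rho> where \<rho>: "irreducible_representation G n \<rho>" "representation G n \<rho>" "n > 0"
    "\<chi> = character_of G \<rho>" using Irr_E[OF assms(1)] by metis
  have expand: "(\<Sum>g\<in>carrier G. \<chi> g * \<psi> (inv g))
    = (\<Sum>i<n. \<Sum>j<k. \<Sum>g\<in>carrier G. \<rho> g $$ (i, i) * \<sigma> (inv g) $$ (j, j))"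
    if "representation G k \<sigma>" "\<psi> = character_of G \<sigma>" for k \<sigma>
  proof -
    have "(\<Sum>g\<in>carrier G. \<chi> g * \<psi> (inv g))
      = (\<Sum>g\<in>carrier G. \<Sum>i<n. \<Sum>j<k. \<rho> g $$ (i, i) * \<sigma> (inv g) $$ (j, j))"
      by (intro sum.cong) (simp_all add: \<rho>(4) that(2) character_of_eq_sum[OF \<rho>(2)] character_of_eq_sum[OF that(1)] sum_product)
    also have "\<dots> = (\<Sum>i<n. \<Sum>j<k. \<Sum>g\<in>carrier G. \<rho> g $$ (i, i) * \<sigma> (inv g) $$ (j, j))"
      by (subst sum.swap, intro sum.cong refl, rule sum.swap)
    finally show ?thesis .
  qed
  show ?thesis
  proof (cases "\<chi> = \<psi>")
    case True
    have "(\<Sum>g\<in>carrier G. \<chi> g * \<psi> (inv g))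
      = (\<Sum>i<n. \<Sum>j<n. \<Sum>g\<in>carrier G. \<rho> g $$ (i, i) * \<rho> (inv g) $$ (j, j))"
      by (rule expand) (use \<rho> True in auto)
    also have "\<dots> = (\<Sum>i<n. \<Sum>j<n. if i = j then of_nat (card (carrier G)) / of_nat n else 0)"
      by (intro sum.cong refl) (simp add: schur_orthogonality_same[OF \<rho>(1)])
    also have "\<dots> = of_nat (card (carrier G))" using \<rho>(3) by (simp add: sum.delta)
    finally show ?thesis using True by simp
  next
    case False
    obtain k \<sigma> where \<sigma>: "irreducible_representation G k \<sigma>" "representation G k \<sigma>"
      "\<psi> = character_of G \<sigma>" using Irr_E[OF assms(2)] by metis
    have "character_of G \<rho> \<noteq> character_of G \<sigma>" using False \<rho>(4) \<sigma>(3) by simp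
    then show ?thesis using False
      unfolding expand[OF \<sigma>(2,3)] by (simp add: schur_orthogonality_distinct[OF \<rho>(1) \<sigma>(1)])
  qed
qed

text \<open>Averaging \<open>\<rho> g * \<rho> y * \<rho> (inv g)\<close> over the group gives a
  scalar matrix with the trace of \<open>\<rho> y\<close>, so the scalar is
  \<open>\<chi> y / \<chi> \<one>\<close>; multiplying by \<open>\<rho> x\<close> and taking traces
  gives the formula. The proof carries this out on matrix entries.\<close>

lemma sum_character_conjugates:
  assumes \<chi>: "\<chi> \<in> Irr G" and xy: "x \<in> carrier G" "y \<in> carrier G"
  shows "(\<Sum>g\<in>carrier G. \<chi> (x \<otimes> (g \<otimes> (y \<otimes> inv g))))
    = of_nat (card (carrier G)) / \<chi> \<one> * \<chi> x * \<chi> y"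
proof -
  obtain n \<rho> where \<rho>: "irreducible_representation G n \<rho>" "representation G n \<rho>" "n > 0"
    "\<chi> = character_of G \<rho>" "\<chi> \<one> = of_nat n" using Irr_E[OF \<chi>] by metis
  let ?N = "of_nat (card (carrier G)) / of_nat n :: complex"
  have "(\<Sum>g\<in>carrier G. \<chi> (x \<otimes> (g \<otimes> (y \<otimes> inv g))))
     = (\<Sum>g\<in>carrier G. \<Sum>i<n. \<Sum>j<n. \<Sum>k<n. \<Sum>l<n.
          \<rho> x $$ (i, j) * \<rho> y $$ (k, l) * (\<rho> g $$ (j, k) * \<rho> (inv g) $$ (l, i)))"
  proof (rule sum.cong)
    fix g assume g: "g \<in> carrier G"
    have "\<chi> (x \<otimes> (g \<otimes> (y \<otimes> inv g))) = (\<Sum>i<n. \<Sum>j<n. \<rho> x $$ (i, j) *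
      (\<Sum>k<n. \<rho> g $$ (j, k) * (\<Sum>l<n. \<rho> y $$ (k, l) * \<rho> (inv g) $$ (l, i))))"
      using xy g by (simp add: \<rho>(4) character_of_eq_sum[OF \<rho>(2)] representation_index_mult[OF \<rho>(2)])
    then show "\<chi> (x \<otimes> (g \<otimes> (y \<otimes> inv g))) = (\<Sum>i<n. \<Sum>j<n. \<Sum>k<n. \<Sum>l<n.
          \<rho> x $$ (i, j) * \<rho> y $$ (k, l) * (\<rho> g $$ (j, k) * \<rho> (inv g) $$ (l, i)))"
      by (simp add: sum_distrib_left mult_ac)
  qed simp
  also have "\<dots> = (\<Sum>i<n. \<Sum>j<n. \<Sum>k<n. \<Sum>l<n. \<rho> x $$ (i, j) * \<rho> y $$ (k, l) *
      (\<Sum>g\<in>carrier G. \<rho> g $$ (j, k) * \<rho> (inv g) $$ (l, i)))"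
    by (subst sum.swap, intro sum.cong refl, subst sum.swap, intro sum.cong refl,
        subst sum.swap, intro sum.cong refl, subst sum.swap, intro sum.cong refl, rule sum_distrib_left[symmetric])
  \<comment> \<open>Schur orthogonality leaves only \<open>j = i\<close> and \<open>k = l\<close>,
    which splits the fourfold sum into the traces of \<open>\<rho> x\<close> and
    \<open>\<rho> y\<close>.\<close>
  also have "\<dots> = (\<Sum>i<n. \<Sum>j<n. \<Sum>k<n. \<Sum>l<n. if j = i \<and> k = l then \<rho> x $$ (i, i) * \<rho> y $$ (k, k) * ?N else 0)"
    by (intro sum.cong refl) (simp add: schur_orthogonality_same[OF \<rho>(1)])
  also have "\<dots> = (\<Sum>i<n. \<Sum>j<n. if j = i then (\<Sum>k<n. \<rho> x $$ (i, i) * \<rho> y $$ (k, k) * ?N) else 0)"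
  proof (intro sum.cong refl)
    fix i j
    show "(\<Sum>k<n. \<Sum>l<n. if j = i \<and> k = l then \<rho> x $$ (i, i) * \<rho> y $$ (k, k) * ?N else 0)
      = (if j = i then (\<Sum>k<n. \<rho> x $$ (i, i) * \<rho> y $$ (k, k) * ?N) else 0)"
      by (cases "j = i") (simp_all add: sum.delta)
  qed
  also have "\<dots> = (\<Sum>i<n. \<Sum>k<n. \<rho> x $$ (i, i) * \<rho> y $$ (k, k) * ?N)"
    by (rule sum.cong[OF refl]) (simp add: sum.delta)
  also have "\<dots> = ?N * \<chi> x * \<chi> y"
    using xy by (simp add: \<rho>(4) character_of_eq_sum[OF \<rho>(2)] sum_product sum_distrib_left sum_divide_distrib mult_ac)
  finally show ?thesis by (simp add: \<rho>(5))
qed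

end

section \<open>Invariant forms and adapted bases\<close>

lemma det_nonzero_inverse:
  fixes A :: "'a :: field mat"
  assumes A: "A \<in> carrier_mat n n" and "det A \<noteq> 0"
  obtains B where "B \<in> carrier_mat n n" "A * B = 1\<^sub>m n" "B * A = 1\<^sub>m n"
  using det_non_zero_imp_unit[OF assms, of "()"] by (auto simp: Units_def ring_mat_simps)

lemma index_mult_mat_vec_sum:
  assumes "A \<in> carrier_mat n k" "v \<in> carrier_vec k" "i < n"
  shows "(A *\<^sub>v v) $ i = (\<Sum>p<k. A $$ (i, p) * v $ p)"
  using assms by (simp add: scalar_prod_def atLeast0LessThan)

lemma mat_trace_cnj_transpose:
  assumes "A \<in> carrier_mat n n"
  shows "mat_trace (mat n n (\<lambda>(i, j). cnj (A $$ (j, i)))) = cnj (mat_trace A)"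
  using assms by (simp add: mat_trace_def)

section \<open>Values of characters at inverses\<close>

context fin_group
begin

lemma sum_mult_right:
  assumes "h \<in> carrier G"
  shows "(\<Sum>g\<in>carrier G. f (g \<otimes> h)) = (\<Sum>g\<in>carrier G. f g)"
  by (rule sum.reindex_bij_witness[of _ "\<lambda>g. g \<otimes> inv h" "\<lambda>g. g \<otimes> h"])
     (use assms in \<open>auto simp: m_assoc\<close>)

text \<open>The matrix \<open>H\<close> is the Gram matrix of the Hermitian form obtained by averaging the
  standard one over the group; being invariant, it intertwines \<open>\<rho>\<close> with its dual.\<close>

lemma character_inv:
  assumes \<rho>: "representation G n \<rho>" and h: "h \<in> carrier G"
  shows "character_of G \<rho> (inv h) = cnj (character_of G \<rho> h)"
proof -
  define H where "H = mat n n (\<lambda>(i, j). \<Sum>g\<in>carrier G. \<Sum>p<n. cnj (\<rho> g $$ (p, i)) * \<rho> g $$ (p, j))"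
  have H: "H \<in> carrier_mat n n" by (simp add: H_def)
  define A where "A = mat n n (\<lambda>(i, j). cnj (\<rho> h $$ (j, i)))"
  have A: "A \<in> carrier_mat n n" by (simp add: A_def)
  note c = representation_carrier[OF \<rho> h] representation_carrier[OF \<rho> inv_closed[OF h]]
  \<comment> \<open>The form is positive definite: a vector \<open>v\<close> in the kernel of
    \<open>H\<close> makes the sum of all squared norms of \<open>\<rho> g *\<^sub>v v\<close>
    vanish, and the term at \<open>\<one>\<close> is the squared norm of \<open>v\<close>
    itself.\<close>
  have "det H \<noteq> 0"
  proof
    assume "det H = 0"
    then obtain v where v: "v \<in> carrier_vec n" "v \<noteq> 0\<^sub>v n" "H *\<^sub>v v = 0\<^sub>v n"
      using det_0_iff_vec_prod_zero[OF H] by auto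
    define u where "u g p = (\<Sum>j<n. \<rho> g $$ (p, j) * v $ j)" for g p
    have "(\<Sum>g\<in>carrier G. \<Sum>p<n. cnj (u g p) * u g p)
      = (\<Sum>g\<in>carrier G. \<Sum>p<n. \<Sum>i<n. \<Sum>j<n. cnj (v $ i) * (cnj (\<rho> g $$ (p, i)) * \<rho> g $$ (p, j) * v $ j))"
      unfolding u_def cnj_sum sum_product by (intro sum.cong refl) (simp add: mult_ac)
    also have "\<dots> = (\<Sum>i<n. \<Sum>j<n. \<Sum>g\<in>carrier G. \<Sum>p<n. cnj (v $ i) * (cnj (\<rho> g $$ (p, i)) * \<rho> g $$ (p, j) * v $ j))"
    proof -
      have "(\<Sum>g\<in>carrier G. \<Sum>p<n. \<Sum>i<n. \<Sum>j<n. F g p i j)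
        = (\<Sum>i<n. \<Sum>j<n. \<Sum>g\<in>carrier G. \<Sum>p<n. F g p i j)" for F :: "'a \<Rightarrow> nat \<Rightarrow> nat \<Rightarrow> nat \<Rightarrow> complex"
      proof -
        have "(\<Sum>g\<in>carrier G. \<Sum>p<n. \<Sum>i<n. \<Sum>j<n. F g p i j)
          = (\<Sum>g\<in>carrier G. \<Sum>i<n. \<Sum>p<n. \<Sum>j<n. F g p i j)"
          by (intro sum.cong refl sum.swap)
        also have "\<dots> = (\<Sum>g\<in>carrier G. \<Sum>i<n. \<Sum>j<n. \<Sum>p<n. F g p i j)"
          by (intro sum.cong refl sum.swap)
        also have "\<dots> = (\<Sum>i<n. \<Sum>g\<in>carrier G. \<Sum>j<n. \<Sum>p<n. F g p i j)"
          by (rule sum.swap)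
        also have "\<dots> = (\<Sum>i<n. \<Sum>j<n. \<Sum>g\<in>carrier G. \<Sum>p<n. F g p i j)"
          by (rule sum.cong[OF refl], rule sum.swap)
        finally show ?thesis .
      qed
      then show ?thesis .
    qed
    also have "\<dots> = (\<Sum>i<n. cnj (v $ i) * (\<Sum>j<n. H $$ (i, j) * v $ j))"
      by (simp add: H_def sum_distrib_left sum_distrib_right mult_ac)
    also have "\<dots> = (\<Sum>i<n. cnj (v $ i) * (H *\<^sub>v v) $ i)"
      by (simp add: index_mult_mat_vec_sum[OF H v(1)])
    also have "\<dots> = 0" unfolding v(3) by simp
    finally have "(\<Sum>g\<in>carrier G. \<Sum>p<n. (cmod (u g p))\<^sup>2) = 0"
      by (simp add: mult.commute[of "cnj _"] complex_norm_square[symmetric] flip: of_real_sum of_real_power)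
    then have "(\<Sum>p<n. (cmod (u \<one> p))\<^sup>2) = 0"
      using finite_carrier by (subst (asm) sum_nonneg_eq_0_iff) (auto intro: sum_nonneg)
    then have *: "u \<one> p = 0" if "p < n" for p
      using that by (subst (asm) sum_nonneg_eq_0_iff) auto
    have "v = 0\<^sub>v n"
    proof (rule eq_vecI)
      fix p assume p: "p < dim_vec (0\<^sub>v n :: complex vec)"
      have "u \<one> p = (\<Sum>j<n. if p = j then v $ j else 0)"
        unfolding u_def representation_one[OF group_axioms \<rho>] using p
        by (intro sum.cong) auto
      then show "v $ p = 0\<^sub>v n $ p" using * p by (simp add: sum.delta)
    qed (use v in auto)
    with v show False by simp
  qed
  then obtain B where B: "B \<in> carrier_mat n n" "H * B = 1\<^sub>m n" "B * H = 1\<^sub>m n"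
    using det_nonzero_inverse[OF H] by blast
  \<comment> \<open>\<open>A\<close> is the conjugate transpose of \<open>\<rho> h\<close>. The left
    side sums the conjugate transpose of \<open>\<rho> (g \<otimes> h)\<close> times
    \<open>\<rho> g\<close>; replacing \<open>g\<close> by \<open>g \<otimes> inv h\<close> moves
    the group element to the right factor.\<close>
  have AH: "A * H = H * \<rho> (inv h)"
  proof (rule eq_matI)
    fix i j assume "i < dim_row (H * \<rho> (inv h))" "j < dim_col (H * \<rho> (inv h))"
    then have ij: "i < n" "j < n" using H c by auto
    define F where "F g = (\<Sum>p<n. cnj (\<rho> (g \<otimes> h) $$ (p, i)) * \<rho> g $$ (p, j))" for g
    have "(A * H) $$ (i, j) = (\<Sum>r<n. A $$ (i, r) * H $$ (r, j))"
      by (rule index_mult_mat_sum[OF A H ij])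
    also have "\<dots> = (\<Sum>r<n. \<Sum>g\<in>carrier G. \<Sum>p<n. cnj (\<rho> g $$ (p, r) * \<rho> h $$ (r, i)) * \<rho> g $$ (p, j))"
      using ij by (simp add: A_def H_def sum_distrib_left mult_ac)
    also have "\<dots> = (\<Sum>g\<in>carrier G. \<Sum>r<n. \<Sum>p<n. cnj (\<rho> g $$ (p, r) * \<rho> h $$ (r, i)) * \<rho> g $$ (p, j))"
      by (rule sum.swap)
    also have "\<dots> = (\<Sum>g\<in>carrier G. \<Sum>p<n. \<Sum>r<n. cnj (\<rho> g $$ (p, r) * \<rho> h $$ (r, i)) * \<rho> g $$ (p, j))"
      by (rule sum.cong[OF refl], rule sum.swap)
    also have "\<dots> = (\<Sum>g\<in>carrier G. F g)"
      using ij h by (simp add: F_def representation_index_mult[OF \<rho>] sum_distrib_right)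
    also have "\<dots> = (\<Sum>g\<in>carrier G. F (g \<otimes> inv h))"
      by (rule sum_mult_right[symmetric]) (use h in simp)
    also have "\<dots> = (\<Sum>g\<in>carrier G. \<Sum>p<n. \<Sum>r<n. cnj (\<rho> g $$ (p, i)) * \<rho> g $$ (p, r) * \<rho> (inv h) $$ (r, j))"
    proof (rule sum.cong[OF refl])
      fix g assume g: "g \<in> carrier G"
      have e: "g \<otimes> inv h \<otimes> h = g" using g h by (simp add: m_assoc)
      show "F (g \<otimes> inv h) = (\<Sum>p<n. \<Sum>r<n. cnj (\<rho> g $$ (p, i)) * \<rho> g $$ (p, r) * \<rho> (inv h) $$ (r, j))"
        using ij g h by (simp add: F_def e representation_index_mult[OF \<rho>, of g "inv h"] sum_distrib_left mult_ac)
    qed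
    also have "\<dots> = (\<Sum>g\<in>carrier G. \<Sum>r<n. \<Sum>p<n. cnj (\<rho> g $$ (p, i)) * \<rho> g $$ (p, r) * \<rho> (inv h) $$ (r, j))"
      by (rule sum.cong[OF refl], rule sum.swap)
    also have "\<dots> = (\<Sum>r<n. \<Sum>g\<in>carrier G. \<Sum>p<n. cnj (\<rho> g $$ (p, i)) * \<rho> g $$ (p, r) * \<rho> (inv h) $$ (r, j))"
      by (rule sum.swap)
    also have "\<dots> = (\<Sum>r<n. H $$ (i, r) * \<rho> (inv h) $$ (r, j))"
      using ij by (simp add: H_def sum_distrib_right)
    also have "\<dots> = (H * \<rho> (inv h)) $$ (i, j)"
      by (rule index_mult_mat_sum[OF H c(2) ij, symmetric])
    finally show "(A * H) $$ (i, j) = (H * \<rho> (inv h)) $$ (i, j)" .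
  qed (use A H c in auto)
  \<comment> \<open>So \<open>\<rho> (inv h)\<close> is similar to \<open>A\<close> through
    \<open>H\<close>, and similar matrices have equal traces.\<close>
  have "\<rho> (inv h) = B * H * \<rho> (inv h)" unfolding B(3) by (rule left_mult_one_mat[OF c(2), symmetric])
  also have "\<dots> = B * (A * H)" unfolding AH by (rule assoc_mult_mat[OF B(1) H c(2)])
  finally have "mat_trace (\<rho> (inv h)) = mat_trace (B * (A * H))" by (rule arg_cong)
  also have "\<dots> = mat_trace (A * H * B)"
    by (rule mat_trace_comm_rect[OF B(1) mult_carrier_mat[OF A H]])
  also have "A * H * B = A * (H * B)" by (rule assoc_mult_mat[OF A H B(1)])
  also have "\<dots> = A" unfolding B(2) by (rule right_mult_one_mat[OF A])
  also have "mat_trace A = cnj (mat_trace (\<rho> h))"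
    unfolding A_def by (rule mat_trace_cnj_transpose[OF c(1)])
  finally show ?thesis using h by (simp add: character_of_def)
qed

end

section \<open>Bases adapted to a subspace\<close>

lemma mult_mat_vec_mem:
  fixes P :: "complex mat"
  assumes P: "P \<in> carrier_mat n k" and cols: "\<And>j. j < k \<Longrightarrow> col P j \<in> W"
    and W: "0\<^sub>v n \<in> W" "\<And>v w. v \<in> W \<Longrightarrow> w \<in> W \<Longrightarrow> v + w \<in> W" "\<And>c v. v \<in> W \<Longrightarrow> c \<cdot>\<^sub>v v \<in> W"
    and u: "u \<in> carrier_vec k"
  shows "P *\<^sub>v u \<in> W"
proof -
  \<comment> \<open>The product is built up one column at a time: coordinates of \<open>u\<close>
    from \<open>m\<close> on are set to zero, and passing to \<open>Suc m\<close> adds the multiple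
    \<open>u $ m\<close> of column \<open>m\<close>.\<close>
  have "P *\<^sub>v vec k (\<lambda>i. if i < m then u $ i else 0) \<in> W" if "m \<le> k" for m
    using that
  proof (induction m)
    case 0
    have "vec k (\<lambda>i. if i < 0 then u $ i else 0) = 0\<^sub>v k" by (intro eq_vecI) auto
    then show ?case using mult_mat_zero_vec[OF P] W(1) by simp
  next
    case (Suc m)
    have eq: "P *\<^sub>v vec k (\<lambda>i. if i < Suc m then u $ i else 0)
      = P *\<^sub>v vec k (\<lambda>i. if i < m then u $ i else 0) + u $ m \<cdot>\<^sub>v col P m"
    proof (rule eq_vecI)
      fix i assume "i < dim_vec (P *\<^sub>v vec k (\<lambda>i. if i < m then u $ i else 0) + u $ m \<cdot>\<^sub>v col P m)"
      then have i: "i < n" using P by simp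
      have "(P *\<^sub>v vec k (\<lambda>i. if i < Suc m then u $ i else 0)) $ i
        = (\<Sum>p<k. P $$ (i, p) * (if p < m then u $ p else 0) + (if p = m then P $$ (i, p) * u $ p else 0))"
        unfolding index_mult_mat_vec_sum[OF P vec_carrier i]
        by (rule sum.cong[OF refl]) (auto simp: less_Suc_eq)
      also have "\<dots> = (\<Sum>p<k. P $$ (i, p) * (if p < m then u $ p else 0)) + P $$ (i, m) * u $ m"
        using Suc.prems by (simp add: sum.distrib sum.delta)
      finally show "(P *\<^sub>v vec k (\<lambda>i. if i < Suc m then u $ i else 0)) $ i
        = (P *\<^sub>v vec k (\<lambda>i. if i < m then u $ i else 0) + u $ m \<cdot>\<^sub>v col P m) $ i"
        using i P Suc.prems by (simp add: index_mult_mat_vec_sum[OF P] del: index_mult_mat_vec)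
    qed (use P in auto)
    show ?case unfolding eq by (intro W Suc.IH cols) (use Suc.prems in auto)
  qed
  from this[of k] have "P *\<^sub>v vec k (\<lambda>i. if i < k then u $ i else 0) \<in> W" by simp
  also have "vec k (\<lambda>i. if i < k then u $ i else 0) = u" using u by (intro eq_vecI) auto
  finally show ?thesis .
qed

text \<open>A maximal set \<open>K\<close> of columns of an invertible matrix lying in \<open>W\<close> exhausts \<open>W\<close>: a vector
  of \<open>W\<close> with a nonzero coordinate outside \<open>K\<close> could replace the corresponding column.\<close>

lemma adapted_invertible_matrix:
  fixes W :: "complex vec set"
  assumes W: "W \<subseteq> carrier_vec n" "0\<^sub>v n \<in> W" "\<And>v w. v \<in> W \<Longrightarrow> w \<in> W \<Longrightarrow> v + w \<in> W"
      "\<And>c v. v \<in> W \<Longrightarrow> c \<cdot>\<^sub>v v \<in> W"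
    and ne: "W \<noteq> {0\<^sub>v n}" "W \<noteq> carrier_vec n"
  obtains P Q K where "P \<in> carrier_mat n n" "Q \<in> carrier_mat n n" "P * Q = 1\<^sub>m n" "Q * P = 1\<^sub>m n"
    "K \<subset> {..<n}" "K \<noteq> {}" "\<And>j. j \<in> K \<Longrightarrow> col P j \<in> W"
    "\<And>w i. w \<in> W \<Longrightarrow> i < n \<Longrightarrow> i \<notin> K \<Longrightarrow> (Q *\<^sub>v w) $ i = 0"
proof -
  define \<S> where "\<S> = {K. K \<subseteq> {..<n} \<and> (\<exists>P\<in>carrier_mat n n. det P \<noteq> 0 \<and> (\<forall>j\<in>K. col P j \<in> W))}"
  have "finite \<S>" by (rule finite_subset[of _ "Pow {..<n}"]) (auto simp: \<S>_def)
  moreover have "{} \<in> \<S>" unfolding \<S>_def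
    by (intro CollectI conjI bexI[of _ "1\<^sub>m n"]) auto
  ultimately obtain K where K: "K \<in> \<S>" "\<And>L. L \<in> \<S> \<Longrightarrow> K \<subseteq> L \<Longrightarrow> L = K"
    using finite_has_maximal[of \<S>] by blast
  then obtain P where P: "P \<in> carrier_mat n n" "det P \<noteq> 0" and cols: "\<And>j. j \<in> K \<Longrightarrow> col P j \<in> W"
    and Kn: "K \<subseteq> {..<n}" by (auto simp: \<S>_def)
  obtain Q where Q: "Q \<in> carrier_mat n n" "P * Q = 1\<^sub>m n" "Q * P = 1\<^sub>m n"
    using det_nonzero_inverse[OF P] by blast
  have PQ: "P *\<^sub>v (Q *\<^sub>v w) = w" if "w \<in> carrier_vec n" for w
    using assoc_mult_mat_vec[OF P(1) Q(1) that] one_mult_mat_vec[OF that] Q(2) by simp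
  have supp: "(Q *\<^sub>v w) $ i = 0" if w: "w \<in> W" and i: "i < n" "i \<notin> K" for w i
  proof (rule ccontr)
    assume nz: "(Q *\<^sub>v w) $ i \<noteq> 0"
    define P' where "P' = replace_col P w i"
    have wn: "w \<in> carrier_vec n" using w W(1) by blast
    have P': "P' \<in> carrier_mat n n" using P by (auto simp: P'_def replace_col_def)
    \<comment> \<open>Cramer's rule for the linear system with matrix \<open>P\<close>, right-hand
      side \<open>w\<close> and solution \<open>Q *\<^sub>v w\<close>.\<close>
    have "det P' = (Q *\<^sub>v w) $ i * det P"
      using cramer_lemma_mat[OF P(1) mult_mat_vec_carrier[OF Q(1) wn] i(1)]
      by (simp only: P'_def PQ[OF wn])
    with nz P have "det P' \<noteq> 0" by simp
    moreover have "col P' j \<in> W" if j: "j \<in> insert i K" for j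
    proof (cases "j = i")
      case True
      then have "col P' j = w" using P(1) wn i by (auto simp: P'_def replace_col_def)
      then show ?thesis using w by simp
    next
      case False
      with j have "j \<in> K" by simp
      then have "col P' j = col P j" using P(1) subsetD[OF Kn, of j] False by (auto simp: P'_def replace_col_def)
      then show ?thesis using cols \<open>j \<in> K\<close> by simp
    qed
    ultimately have "insert i K \<in> \<S>" using P' Kn i by (auto simp: \<S>_def)
    then show False using K(2) i by blast
  qed
  have "K \<noteq> {}"
  proof
    assume "K = {}"
    have "w = 0\<^sub>v n" if w: "w \<in> W" for w
    proof -
      have wn: "w \<in> carrier_vec n" using w W(1) by blast
      have "Q *\<^sub>v w = 0\<^sub>v n"
        using supp[OF w] \<open>K = {}\<close> Q(1) by (intro eq_vecI) (auto simp del: index_mult_mat_vec)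
      then show ?thesis using PQ[OF wn] mult_mat_zero_vec[OF P(1)] by simp
    qed
    with W(2) ne(1) show False by blast
  qed
  moreover have "K \<noteq> {..<n}"
  proof
    assume "K = {..<n}"
    have "v \<in> W" if v: "v \<in> carrier_vec n" for v
    proof -
      have "P *\<^sub>v (Q *\<^sub>v v) \<in> W"
        using cols \<open>K = {..<n}\<close> by (intro mult_mat_vec_mem[OF P(1) _ W(2-4) mult_mat_vec_carrier[OF Q(1) v]]) auto
      then show ?thesis using PQ[OF v] by simp
    qed
    with W(1) ne(2) show False by blast
  qed
  ultimately show ?thesis using that P Q Kn cols supp by blast
qed

section \<open>The regular character and column orthogonality\<close>

context fin_group
begin

text \<open>The diagonal block of \<open>A\<close> on the index set \<open>S\<close> is
  multiplicative as soon as the terms of the matrix product that pass through an index outside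
  \<open>S\<close> vanish. Asking this of products of entries serves both diagonal blocks of a block
  triangular form, where the zero sits in different factors.\<close>

lemma representation_compress:
  assumes A: "representation G n A" and S: "S \<subseteq> {..<n}"
    and block: "\<And>g h i j p. g \<in> carrier G \<Longrightarrow> h \<in> carrier G \<Longrightarrow> i \<in> S \<Longrightarrow> j \<in> S
      \<Longrightarrow> p < n \<Longrightarrow> p \<notin> S \<Longrightarrow> A g $$ (i, p) * A h $$ (p, j) = 0"
  obtains B where "representation G (card S) B"
    "\<And>g. g \<in> carrier G \<Longrightarrow> character_of G B g = (\<Sum>i\<in>S. A g $$ (i, i))"
proof -
  have "finite S" using S finite_subset by blast
  then obtain e where e: "bij_betw e {0..<card S} S" using ex_bij_betw_nat_finite by blast
  let ?k = "card S"
  have e': "bij_betw e {..<?k} S" using e by (simp add: lessThan_atLeast0)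
  have eS: "e i \<in> S" if "i < ?k" for i using e' that by (auto simp: bij_betw_def)
  have en: "e i < n" if "i < ?k" for i using eS[OF that] S by auto
  have e_inj: "e i = e j \<longleftrightarrow> i = j" if "i < ?k" "j < ?k" for i j
    using e' that by (auto simp: bij_betw_def inj_on_def)
  define B where "B g = mat ?k ?k (\<lambda>(i, j). A g $$ (e i, e j))" for g
  have B: "B g \<in> carrier_mat ?k ?k" for g by (simp add: B_def)
  have rep: "representation G ?k B"
  proof (rule representationI)
    fix g h assume gh: "g \<in> carrier G" "h \<in> carrier G"
    show "B (g \<otimes> h) = B g * B h"
    proof (rule eq_matI)
      fix i j assume "i < dim_row (B g * B h)" "j < dim_col (B g * B h)"
      then have ij: "i < ?k" "j < ?k" by (auto simp: B_def)
      have "B (g \<otimes> h) $$ (i, j) = (\<Sum>p<n. A g $$ (e i, p) * A h $$ (p, e j))"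
        using ij en by (simp add: B_def representation_index_mult[OF A gh])
      also have "\<dots> = (\<Sum>p\<in>S. A g $$ (e i, p) * A h $$ (p, e j))"
        using S block[OF gh eS[OF ij(1)] eS[OF ij(2)]] by (intro sum.mono_neutral_right) auto
      also have "\<dots> = (\<Sum>p<?k. A g $$ (e i, e p) * A h $$ (e p, e j))"
        by (rule sum.reindex_bij_betw[OF e', symmetric])
      also have "\<dots> = (\<Sum>p<?k. B g $$ (i, p) * B h $$ (p, j))"
        using ij by (simp add: B_def)
      also have "\<dots> = (B g * B h) $$ (i, j)" by (rule index_mult_mat_sum[OF B B ij, symmetric])
      finally show "B (g \<otimes> h) $$ (i, j) = (B g * B h) $$ (i, j)" .
    qed (auto simp: B_def)
  next
    show "B \<one> = 1\<^sub>m ?k"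
      using en e_inj by (intro eq_matI) (auto simp: B_def representation_one[OF group_axioms A])
  qed (rule B)
  have "character_of G B g = (\<Sum>i\<in>S. A g $$ (i, i))" if g: "g \<in> carrier G" for g
  proof -
    have "character_of G B g = (\<Sum>i<?k. A g $$ (e i, e i))"
      by (simp add: character_of_eq_sum[OF rep g] B_def)
    also have "\<dots> = (\<Sum>i\<in>S. A g $$ (i, i))" by (rule sum.reindex_bij_betw[OF e'])
    finally show ?thesis .
  qed
  with rep show ?thesis using that by blast
qed

text \<open>In a basis whose part indexed by \<open>K\<close> spans the invariant subspace, the
  matrices become block triangular. The two diagonal blocks represent the action on the subspace and
  on the quotient, and the trace is the sum of theirs.\<close>

lemma reducible_character_split:
  assumes \<rho>: "representation G n \<rho>" and n: "n > 0" and red: "\<not> irreducible_representation G n \<rho>"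
  obtains k \<sigma> l \<tau> where "k < n" "representation G k \<sigma>" "l < n" "representation G l \<tau>"
    "\<And>g. g \<in> carrier G \<Longrightarrow> character_of G \<rho> g = character_of G \<sigma> g + character_of G \<tau> g"
proof -
  obtain W where W: "invariant_subspace G n \<rho> W" "W \<noteq> {0\<^sub>v n}" "W \<noteq> carrier_vec n"
    using \<rho> n red by (auto simp: irreducible_representation_def)
  then have sub: "submodule class_ring W (module_vec TYPE(complex) n)"
    and inv: "\<And>g w. g \<in> carrier G \<Longrightarrow> w \<in> W \<Longrightarrow> \<rho> g *\<^sub>v w \<in> W"
    by (auto simp: invariant_subspace_def VectorSpace.subspace_def)
  have sub': "W \<subseteq> carrier_vec n" "0\<^sub>v n \<in> W" "\<And>v w. v \<in> W \<Longrightarrow> w \<in> W \<Longrightarrow> v + w \<in> W"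
      "\<And>c v. v \<in> W \<Longrightarrow> c \<cdot>\<^sub>v v \<in> W"
    using sub by (auto simp: LinearCombinations.submodule_def module_vec_simps)
  obtain P Q K where PQ: "P \<in> carrier_mat n n" "Q \<in> carrier_mat n n" "P * Q = 1\<^sub>m n" "Q * P = 1\<^sub>m n"
    and K: "K \<subset> {..<n}" "K \<noteq> {}" and cols: "\<And>j. j \<in> K \<Longrightarrow> col P j \<in> W"
    and supp: "\<And>w i. w \<in> W \<Longrightarrow> i < n \<Longrightarrow> i \<notin> K \<Longrightarrow> (Q *\<^sub>v w) $ i = 0"
    using adapted_invertible_matrix[OF sub' W(2,3)] by blast
  note c = representation_carrier[OF \<rho>]
  define A where "A g = Q * (\<rho> g * P)" for g
  have \<rho>P: "\<rho> g * P \<in> carrier_mat n n" if "g \<in> carrier G" for g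
    by (rule mult_carrier_mat[OF c[OF that] PQ(1)])
  have Ac: "A g \<in> carrier_mat n n" if "g \<in> carrier G" for g
    unfolding A_def by (rule mult_carrier_mat[OF PQ(2) \<rho>P[OF that]])
  have A: "representation G n A"
  proof (rule representationI)
    fix g h assume gh: "g \<in> carrier G" "h \<in> carrier G"
    have "A g * A h = Q * (\<rho> g * P * (Q * (\<rho> h * P)))"
      unfolding A_def by (rule assoc_mult_mat[OF PQ(2) \<rho>P[OF gh(1)] mult_carrier_mat[OF PQ(2) \<rho>P[OF gh(2)]]])
    also have "\<rho> g * P * (Q * (\<rho> h * P)) = \<rho> g * (P * (Q * (\<rho> h * P)))"
      by (rule assoc_mult_mat[OF c[OF gh(1)] PQ(1) mult_carrier_mat[OF PQ(2) \<rho>P[OF gh(2)]]])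
    also have "P * (Q * (\<rho> h * P)) = P * Q * (\<rho> h * P)"
      by (rule assoc_mult_mat[OF PQ(1,2) \<rho>P[OF gh(2)], symmetric])
    also have "\<dots> = \<rho> h * P" unfolding PQ(3) by (rule left_mult_one_mat[OF \<rho>P[OF gh(2)]])
    also have "\<rho> g * (\<rho> h * P) = \<rho> (g \<otimes> h) * P"
      unfolding representation_mult[OF \<rho> gh]
      by (rule assoc_mult_mat[OF c[OF gh(1)] c[OF gh(2)] PQ(1), symmetric])
    finally show "A (g \<otimes> h) = A g * A h" by (simp only: A_def)
  next
    show "A \<one> = 1\<^sub>m n"
      unfolding A_def representation_one[OF group_axioms \<rho>] left_mult_one_mat[OF PQ(1)] by (rule PQ(4))
  qed (rule Ac)
  have trace: "character_of G \<rho> g = (\<Sum>i<n. A g $$ (i, i))" if g: "g \<in> carrier G" for g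
  proof -
    have "mat_trace (A g) = mat_trace (\<rho> g * P * Q)"
      unfolding A_def by (rule mat_trace_comm_rect[OF PQ(2) \<rho>P[OF g]])
    also have "\<rho> g * P * Q = \<rho> g * (P * Q)" by (rule assoc_mult_mat[OF c[OF g] PQ(1,2)])
    also have "\<dots> = \<rho> g" unfolding PQ(3) by (rule right_mult_one_mat[OF c[OF g]])
    finally show ?thesis using g Ac[OF g] by (simp add: character_of_def mat_trace_def)
  qed
  \<comment> \<open>Column \<open>j\<close> of \<open>P\<close> lies in \<open>W\<close> and
    \<open>\<rho> g\<close> maps it into \<open>W\<close> again, so the image has zero coordinates
    outside \<open>K\<close>.\<close>
  have zero: "A g $$ (i, j) = 0" if g: "g \<in> carrier G" and ij: "i < n" "i \<notin> K" "j \<in> K" for g i j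
  proof -
    have j: "j < n" using ij K by auto
    have "col (A g) j = Q *\<^sub>v (\<rho> g *\<^sub>v col P j)"
      unfolding A_def col_mult2[OF PQ(2) \<rho>P[OF g] j] col_mult2[OF c[OF g] PQ(1) j] ..
    then have "col (A g) j $ i = 0" using supp[OF inv[OF g cols[OF ij(3)]] ij(1,2)] by simp
    then show ?thesis using Ac[OF g] ij j by simp
  qed
  have fin: "finite K" using K(1) finite_subset by blast
  \<comment> \<open>For the block \<open>K\<close> the factor \<open>A h $$ (p, j)\<close> vanishes,
    for its complement the factor \<open>A g $$ (i, p)\<close>.\<close>
  obtain \<sigma> where \<sigma>: "representation G (card K) \<sigma>"
    "\<And>g. g \<in> carrier G \<Longrightarrow> character_of G \<sigma> g = (\<Sum>i\<in>K. A g $$ (i, i))"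
    by (rule representation_compress[OF A, of K]) (use K zero in auto)
  obtain \<tau> where \<tau>: "representation G (card ({..<n} - K)) \<tau>"
    "\<And>g. g \<in> carrier G \<Longrightarrow> character_of G \<tau> g = (\<Sum>i\<in>{..<n} - K. A g $$ (i, i))"
    by (rule representation_compress[OF A, of "{..<n} - K"]) (use zero in auto)
  have "card K < n" using psubset_card_mono[OF _ K(1)] by simp
  moreover have "card ({..<n} - K) < n"
    using psubset_card_mono[of "{..<n}" "{..<n} - K"] K by auto
  moreover have "character_of G \<rho> g = character_of G \<sigma> g + character_of G \<tau> g" if "g \<in> carrier G" for g
    unfolding trace[OF that] \<sigma>(2)[OF that] \<tau>(2)[OF that]
    using K(1) sum.subset_diff[of K "{..<n}" "\<lambda>i. A g $$ (i, i)"] by (simp add: add.commute)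
  ultimately show ?thesis using that \<sigma>(1) \<tau>(1) by blast
qed

text \<open>Splitting is repeated by strong induction on the dimension. A multiset keeps the
  multiplicities, and dimension zero yields the empty one.\<close>

lemma character_decomposition:
  assumes "representation G n \<rho>"
  shows "\<exists>M. set_mset M \<subseteq> Irr G \<and> (\<forall>g\<in>carrier G. character_of G \<rho> g = (\<Sum>\<chi>\<in>#M. \<chi> g))"
  using assms
proof (induction n arbitrary: \<rho> rule: less_induct)
  case (less n)
  consider "n = 0" | "irreducible_representation G n \<rho>" | "n > 0" "\<not> irreducible_representation G n \<rho>"
    by blast
  then show ?case
  proof cases
    case 1
    then show ?thesis
      by (intro exI[of _ "{#}"]) (simp add: character_of_eq_sum[OF less.prems])
  next
    case 2
    then show ?thesis
      by (intro exI[of _ "{#character_of G \<rho>#}"]) (auto simp: Irr_def)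
  next
    case 3
    obtain k \<sigma> l \<tau> where *: "k < n" "representation G k \<sigma>" "l < n" "representation G l \<tau>"
      "\<And>g. g \<in> carrier G \<Longrightarrow> character_of G \<rho> g = character_of G \<sigma> g + character_of G \<tau> g"
      using reducible_character_split[OF less.prems 3] by blast
    obtain M where "set_mset M \<subseteq> Irr G" "\<forall>g\<in>carrier G. character_of G \<sigma> g = (\<Sum>\<chi>\<in>#M. \<chi> g)"
      using less.IH[OF *(1,2)] by blast
    moreover obtain N where "set_mset N \<subseteq> Irr G" "\<forall>g\<in>carrier G. character_of G \<tau> g = (\<Sum>\<chi>\<in>#N. \<chi> g)"
      using less.IH[OF *(3,4)] by blast
    ultimately show ?thesis using *(5) by (intro exI[of _ "M + N"]) auto
  qed
qed

text \<open>The witness is left multiplication on the group, written as permutation matrices along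
  an enumeration \<open>e\<close>. The trace counts the \<open>e i\<close> with
  \<open>e i = g \<otimes> e i\<close>, and only \<open>g = \<one>\<close> fixes any.\<close>

lemma regular_character:
  obtains n \<rho> where "representation G n \<rho>"
    "\<And>g. g \<in> carrier G \<Longrightarrow> character_of G \<rho> g = (if g = \<one> then of_nat (card (carrier G)) else 0)"
proof -
  let ?N = "card (carrier G)"
  obtain e where "bij_betw e {0..<?N} (carrier G)" using ex_bij_betw_nat_finite[OF finite_carrier] by blast
  then have e: "bij_betw e {..<?N} (carrier G)" by (simp add: lessThan_atLeast0)
  have eG: "e i \<in> carrier G" if "i < ?N" for i using e that by (auto simp: bij_betw_def)
  have e_inj: "e i = e j \<longleftrightarrow> i = j" if "i < ?N" "j < ?N" for i j
    using e that by (auto simp: bij_betw_def inj_on_def)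
  define A where "A g = mat ?N ?N (\<lambda>(i, j). if e i = g \<otimes> e j then 1 else 0 :: complex)" for g
  have A: "A g \<in> carrier_mat ?N ?N" for g by (simp add: A_def)
  have rep: "representation G ?N A"
  proof (rule representationI)
    fix g h assume gh: "g \<in> carrier G" "h \<in> carrier G"
    show "A (g \<otimes> h) = A g * A h"
    proof (rule eq_matI)
      fix i j assume "i < dim_row (A g * A h)" "j < dim_col (A g * A h)"
      then have ij: "i < ?N" "j < ?N" by (auto simp: A_def)
      have "(A g * A h) $$ (i, j) = (\<Sum>p<?N. A g $$ (i, p) * A h $$ (p, j))"
        by (rule index_mult_mat_sum[OF A A ij])
      also have "\<dots> = (\<Sum>p<?N. if e p = h \<otimes> e j then if e i = g \<otimes> e p then 1 else 0 else 0)"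
        using ij by (intro sum.cong) (auto simp: A_def)
      also have "\<dots> = (\<Sum>x\<in>carrier G. if x = h \<otimes> e j then if e i = g \<otimes> x then 1 else 0 else 0)"
        by (rule sum.reindex_bij_betw[OF e])
      also have "\<dots> = A (g \<otimes> h) $$ (i, j)"
        using ij gh eG[OF ij(2)] finite_carrier by (simp add: A_def m_assoc sum.delta)
      finally show "A (g \<otimes> h) $$ (i, j) = (A g * A h) $$ (i, j)" ..
    qed (auto simp: A_def)
  next
    show "A \<one> = 1\<^sub>m ?N" using eG e_inj by (intro eq_matI) (auto simp: A_def)
  qed (rule A)
  have "character_of G A g = (if g = \<one> then of_nat ?N else 0)" if g: "g \<in> carrier G" for g
  proof -
    have "e i = g \<otimes> e i \<longleftrightarrow> g = \<one>" if "i < ?N" for i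
      using eG[OF that] g r_cancel_one'[of "e i" g] by auto
    then show ?thesis by (simp add: character_of_eq_sum[OF rep g] A_def)
  qed
  with rep show ?thesis using that by blast
qed

text \<open>Row orthogonality shows that every irreducible character occurs in the regular one with
  multiplicity its degree; being positive, these multiplicities also bound \<open>Irr G\<close>.\<close>

lemma regular_character_decomposition:
  shows finite_Irr: "finite (Irr G)"
    and sum_Irr_degree: "g \<in> carrier G \<Longrightarrow>
      (\<Sum>\<chi>\<in>Irr G. \<chi> \<one> * \<chi> g) = (if g = \<one> then of_nat (card (carrier G)) else 0)"
proof -
  let ?N = "of_nat (card (carrier G)) :: complex"
  obtain n \<rho> where \<rho>: "representation G n \<rho>"
    "\<And>g. g \<in> carrier G \<Longrightarrow> character_of G \<rho> g = (if g = \<one> then ?N else 0)"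
    using regular_character by blast
  obtain M where M: "set_mset M \<subseteq> Irr G"
    "\<And>g. g \<in> carrier G \<Longrightarrow> character_of G \<rho> g = (\<Sum>\<chi>\<in>#M. \<chi> g)"
    using character_decomposition[OF \<rho>(1)] by blast
  have N: "?N \<noteq> 0" using finite_carrier one_closed by auto
  \<comment> \<open>The pairing of the regular character with \<open>\<psi>\<close> is evaluated in
    two ways: through its concentration at \<open>\<one>\<close>, and through row orthogonality
    applied to the constituents in \<open>M\<close>.\<close>
  have count: "of_nat (count M \<psi>) = \<psi> \<one>" if \<psi>: "\<psi> \<in> Irr G" for \<psi>
  proof -
    have swap: "(\<Sum>g\<in>carrier G. (\<Sum>\<chi>\<in>#L. \<chi> g) * \<psi> (inv g))
      = (\<Sum>\<chi>\<in>#L. \<Sum>g\<in>carrier G. \<chi> g * \<psi> (inv g))" for L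
      by (induction L) (auto simp: distrib_right sum.distrib)
    have "?N * \<psi> \<one> = (\<Sum>g\<in>carrier G. if g = \<one> then ?N * \<psi> (inv g) else 0)"
      using finite_carrier by (simp add: sum.delta)
    also have "\<dots> = (\<Sum>g\<in>carrier G. (\<Sum>\<chi>\<in>#M. \<chi> g) * \<psi> (inv g))"
      by (intro sum.cong) (auto simp: \<rho>(2) simp flip: M(2))
    also have "\<dots> = (\<Sum>\<chi>\<in>#M. \<Sum>g\<in>carrier G. \<chi> g * \<psi> (inv g))" by (rule swap)
    also have "\<dots> = (\<Sum>\<chi>\<in>#M. if \<chi> = \<psi> then ?N else 0)"
      using M(1) \<psi> by (intro arg_cong[of _ _ sum_mset] image_mset_cong) (auto simp: row_orthogonality)
    also have "\<dots> = ?N * of_nat (count M \<psi>)" by (rule sum_mset_delta)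
    finally show ?thesis using N by simp
  qed
  have "\<psi> \<in># M" if \<psi>: "\<psi> \<in> Irr G" for \<psi>
  proof -
    obtain n where "n > 0" "\<psi> \<one> = of_nat n" using Irr_E[OF \<psi>] by metis
    then show ?thesis using count[OF \<psi>] by (metis count_greater_zero_iff of_nat_eq_iff)
  qed
  then have IM: "Irr G = set_mset M" using M(1) by blast
  then show fin: "finite (Irr G)" by simp
  assume g: "g \<in> carrier G"
  have sum_mset_count: "(\<Sum>\<chi>\<in>#L. \<chi> g) = (\<Sum>\<chi>\<in>Irr G. of_nat (count L \<chi>) * \<chi> g)"
    if "set_mset L \<subseteq> Irr G" for L
    using that
  proof (induction L)
    case (add x L)
    have "(\<Sum>\<chi>\<in>Irr G. of_nat (count (add_mset x L) \<chi>) * \<chi> g)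
      = (\<Sum>\<chi>\<in>Irr G. of_nat (count L \<chi>) * \<chi> g + (if \<chi> = x then \<chi> g else 0))"
      by (intro sum.cong) (auto simp: algebra_simps)
    also have "\<dots> = (\<Sum>\<chi>\<in>Irr G. of_nat (count L \<chi>) * \<chi> g) + x g"
      using fin add.prems by (simp add: sum.distrib sum.delta)
    finally show ?case using add by simp
  qed simp
  have "(\<Sum>\<chi>\<in>Irr G. \<chi> \<one> * \<chi> g) = (\<Sum>\<chi>\<in>Irr G. of_nat (count M \<chi>) * \<chi> g)"
    by (intro sum.cong) (auto simp: count)
  also have "\<dots> = character_of G \<rho> g" using M g sum_mset_count by simp
  finally show "(\<Sum>\<chi>\<in>Irr G. \<chi> \<one> * \<chi> g) = (if g = \<one> then ?N else 0)"
    using \<rho>(2) g by simp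
qed

text \<open>Both cases of the classical relation are contained in one count: no conjugators exist
  between different classes, and within a class they form a coset of a centralizer. This count is
  what the regular character detects.\<close>

lemma column_orthogonality:
  assumes x: "x \<in> carrier G" and y: "y \<in> carrier G"
  shows "(\<Sum>\<chi>\<in>Irr G. \<chi> x * cnj (\<chi> y)) = of_nat (card {g \<in> carrier G. x = g \<otimes> y \<otimes> inv g})"
proof -
  let ?N = "of_nat (card (carrier G)) :: complex"
  have N: "?N \<noteq> 0" using finite_carrier one_closed by auto
  have cnj: "cnj (\<chi> y) = \<chi> (inv y)" if \<chi>: "\<chi> \<in> Irr G" for \<chi>
    using Irr_E[OF \<chi>] character_inv y by metis
  have one: "\<chi> \<one> \<noteq> 0" if \<chi>: "\<chi> \<in> Irr G" for \<chi>
    using Irr_E[OF \<chi>] by (metis of_nat_eq_0_iff less_irrefl)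
  \<comment> \<open>The inserted factor \<open>\<chi> \<one>\<close> cancels the denominator from
    \<open>sum_character_conjugates\<close> and then serves as the multiplicity of
    \<open>\<chi>\<close> in the regular character.\<close>
  have "?N * (\<Sum>\<chi>\<in>Irr G. \<chi> x * cnj (\<chi> y))
    = (\<Sum>\<chi>\<in>Irr G. \<chi> \<one> * (?N / \<chi> \<one> * \<chi> x * \<chi> (inv y)))"
    unfolding sum_distrib_left by (intro sum.cong) (auto simp: cnj one)
  also have "\<dots> = (\<Sum>\<chi>\<in>Irr G. \<Sum>g\<in>carrier G. \<chi> \<one> * \<chi> (x \<otimes> (g \<otimes> (inv y \<otimes> inv g))))"
    using x y by (simp add: sum_character_conjugates sum_distrib_left[symmetric])
  also have "\<dots> = (\<Sum>g\<in>carrier G. \<Sum>\<chi>\<in>Irr G. \<chi> \<one> * \<chi> (x \<otimes> (g \<otimes> (inv y \<otimes> inv g))))"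
    by (rule sum.swap)
  \<comment> \<open>The inner sum is the regular character at
    \<open>x \<otimes> inv (g \<otimes> y \<otimes> inv g)\<close>, hence nonzero only if this
    element is \<open>\<one>\<close>.\<close>
  also have "\<dots> = (\<Sum>g\<in>carrier G. if x = g \<otimes> y \<otimes> inv g then ?N else 0)"
  proof (intro sum.cong refl)
    fix g assume g: "g \<in> carrier G"
    have "g \<otimes> (inv y \<otimes> inv g) = inv (g \<otimes> y \<otimes> inv g)"
      using g y by (simp add: inv_mult_group)
    moreover have "x \<otimes> inv (g \<otimes> y \<otimes> inv g) = \<one> \<longleftrightarrow> x = g \<otimes> y \<otimes> inv g"
      using g y x by (metis inv_closed inv_equality inv_inv m_closed r_inv)
    ultimately show "(\<Sum>\<chi>\<in>Irr G. \<chi> \<one> * \<chi> (x \<otimes> (g \<otimes> (inv y \<otimes> inv g))))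
      = (if x = g \<otimes> y \<otimes> inv g then ?N else 0)"
      using g x y by (simp add: sum_Irr_degree)
  qed
  also have "\<dots> = ?N * of_nat (card {g \<in> carrier G. x = g \<otimes> y \<otimes> inv g})"
    using finite_carrier by (simp add: sum.If_cases Int_def)
  finally show ?thesis using N by simp
qed

end

section \<open>Linear characters\<close>

lemma degree_one_irreducible:
  assumes "representation G 1 \<rho>"
  shows "irreducible_representation G 1 \<rho>"
  unfolding irreducible_representation_def
proof (intro conjI allI impI)
  fix W assume W: "invariant_subspace G 1 \<rho> W"
  then have "LinearCombinations.submodule class_ring W (module_vec TYPE(complex) 1)"
    by (auto simp: invariant_subspace_def VectorSpace.subspace_def)
  then have sub: "W \<subseteq> carrier_vec 1" "0\<^sub>v 1 \<in> W" "\<And>c v. v \<in> W \<Longrightarrow> c \<cdot>\<^sub>v v \<in> W"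
    by (auto simp: LinearCombinations.submodule_def module_vec_simps)
  show "W = {0\<^sub>v 1} \<or> W = carrier_vec 1"
  proof (cases "W = {0\<^sub>v 1}")
    case False
    then obtain w where w: "w \<in> W" "w \<noteq> 0\<^sub>v 1" using sub(2) by blast
    then have wc: "w \<in> carrier_vec 1" using sub(1) by blast
    have w0: "w $ 0 \<noteq> 0"
    proof
      assume "w $ 0 = 0"
      then have "w = 0\<^sub>v 1" using wc by (intro eq_vecI) auto
      with w show False by simp
    qed
    have "v \<in> W" if v: "v \<in> carrier_vec 1" for v
    proof -
      have "v = (v $ 0 / w $ 0) \<cdot>\<^sub>v w" using v wc w0 by (intro eq_vecI) auto
      then show ?thesis using sub(3)[OF w(1)] by metis
    qed
    then show ?thesis using sub(1) by blast
  qed simp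
qed (use assms in auto)

text \<open>All \<open>\<rho> g\<close> commute, so Schur's lemma makes each a scalar matrix. Then
  the line through the first unit vector is invariant, which contradicts irreducibility once a
  second unit vector exists.\<close>

lemma (in comm_group) irreducible_degree_one:
  assumes \<rho>: "irreducible_representation G n \<rho>"
  shows "n = 1"
proof (rule ccontr)
  assume "n \<noteq> 1"
  have rep: "representation G n \<rho>" and "n > 0"
    using \<rho> by (auto simp: irreducible_representation_def)
  with \<open>n \<noteq> 1\<close> have n: "1 < n" by simp
  have scalar: "\<exists>c. \<rho> g = c \<cdot>\<^sub>m 1\<^sub>m n" if g: "g \<in> carrier G" for g
  proof (rule schur_scalar[OF \<rho> representation_carrier[OF rep g]])
    fix h assume h: "h \<in> carrier G"
    show "\<rho> h * \<rho> g = \<rho> g * \<rho> h"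
      using g h by (simp add: m_comm flip: representation_mult[OF rep])
  qed
  let ?e = "unit_vec n 0 :: complex vec"
  let ?W = "{c \<cdot>\<^sub>v ?e | c. True}"
  have "?W = {0\<^sub>v n} \<or> ?W = carrier_vec n"
  proof (rule irreducible_cases[OF \<rho>])
    show "0\<^sub>v n \<in> ?W" by (intro CollectI exI[of _ 0]) auto
  next
    fix v w assume "v \<in> ?W" "w \<in> ?W"
    then obtain a b where "v = a \<cdot>\<^sub>v ?e" "w = b \<cdot>\<^sub>v ?e" by blast
    then show "v + w \<in> ?W" by (intro CollectI exI[of _ "a + b"]) (simp add: add_smult_distrib_vec)
  next
    fix a v assume "v \<in> ?W"
    then obtain b where "v = b \<cdot>\<^sub>v ?e" by blast
    then show "a \<cdot>\<^sub>v v \<in> ?W" by (intro CollectI exI[of _ "a * b"]) (simp add: smult_smult_assoc)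
  next
    fix g v assume g: "g \<in> carrier G" and "v \<in> ?W"
    then obtain b where v: "v = b \<cdot>\<^sub>v ?e" by blast
    obtain c where c: "\<rho> g = c \<cdot>\<^sub>m 1\<^sub>m n" using scalar[OF g] by blast
    have "\<rho> g *\<^sub>v v = (c * b) \<cdot>\<^sub>v ?e"
      unfolding c v by (intro eq_vecI) (auto simp: row_smult)
    then show "\<rho> g *\<^sub>v v \<in> ?W" by blast
  qed auto
  then show False
  proof
    assume "?W = {0\<^sub>v n}"
    moreover have "1 \<cdot>\<^sub>v ?e \<in> ?W" by blast
    ultimately have "1 \<cdot>\<^sub>v ?e = 0\<^sub>v n" by blast
    then have "(1 \<cdot>\<^sub>v ?e) $ 0 = (0\<^sub>v n :: complex vec) $ 0" by simp
    then show False using n by simp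
  next
    assume "?W = carrier_vec n"
    moreover have "unit_vec n 1 \<in> carrier_vec n" by simp
    ultimately obtain c where "unit_vec n 1 = c \<cdot>\<^sub>v ?e" by blast
    then have "(unit_vec n 1 :: complex vec) $ 1 = (c \<cdot>\<^sub>v ?e) $ 1" by simp
    then show False using n by simp
  qed
qed

section \<open>Linear characters as multiplicative functions\<close>

lemma (in group) representation_degree_oneI:
  assumes "\<And>g h. g \<in> carrier G \<Longrightarrow> h \<in> carrier G \<Longrightarrow> f (g \<otimes> h) = f g * f h" and "f \<one> = 1"
  shows "representation G 1 (\<lambda>g. mat 1 1 (\<lambda>_. f g))"
proof (rule representationI)
  fix g h assume gh: "g \<in> carrier G" "h \<in> carrier G"
  show "mat 1 1 (\<lambda>_. f (g \<otimes> h)) = mat 1 1 (\<lambda>_. f g) * mat 1 1 (\<lambda>_. f h)"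
    by (intro eq_matI) (simp_all add: scalar_prod_def assms(1)[OF gh])
next
  show "mat 1 1 (\<lambda>_. f \<one>) = 1\<^sub>m 1"
    by (intro eq_matI) (simp_all add: assms(2))
qed simp

text \<open>Together with \<open>linear_character_mult\<close> this identifies linear characters
  with multiplicative functions normalised at \<open>\<one>\<close>, so that inflation can be
  checked on values. The restriction to the carrier matches the extensionality built into
  \<open>character_of\<close>.\<close>

lemma (in group) multiplicative_linear_character:
  assumes mult: "\<And>g h. g \<in> carrier G \<Longrightarrow> h \<in> carrier G \<Longrightarrow> f (g \<otimes> h) = f g * f h" and one: "f \<one> = 1"
  shows "restrict f (carrier G) \<in> Irr G" "linear_character G (restrict f (carrier G))"
proof -
  note rep = representation_degree_oneI[of f, OF mult one]
  have eq: "restrict f (carrier G) = character_of G (\<lambda>g. mat 1 1 (\<lambda>_. f g))"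
    by (auto simp: character_of_def mat_trace_def)
  show "restrict f (carrier G) \<in> Irr G"
    unfolding eq Irr_def using degree_one_irreducible[OF rep] by blast
  show "linear_character G (restrict f (carrier G))"
    unfolding eq linear_character_def by (rule char_degree_eq(1)[OF group_axioms rep])
qed

lemma linear_character_mult:
  assumes G: "group G" and \<chi>: "\<chi> \<in> Irr G" "linear_character G \<chi>"
  shows "\<And>g h. g \<in> carrier G \<Longrightarrow> h \<in> carrier G \<Longrightarrow> \<chi> (g \<otimes>\<^bsub>G\<^esub> h) = \<chi> g * \<chi> h"
    and "\<chi> \<one>\<^bsub>G\<^esub> = 1"
proof -
  interpret group G by fact
  obtain n \<rho> where *: "representation G n \<rho>" "\<chi> = character_of G \<rho>"
    using \<chi>(1) by (auto simp: Irr_def irreducible_representation_def)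
  then have rep: "representation G 1 \<rho>"
    using \<chi>(2) char_degree_eq(1)[OF G *(1)] by (simp add: linear_character_def)
  show "\<chi> (g \<otimes>\<^bsub>G\<^esub> h) = \<chi> g * \<chi> h" if "g \<in> carrier G" "h \<in> carrier G" for g h
    using that by (simp add: *(2) character_of_eq_sum[OF rep] representation_index_mult[OF rep])
  show "\<chi> \<one>\<^bsub>G\<^esub> = 1" using char_degree_eq(2)[OF G rep] by (simp add: *(2))
qed

lemma Irr_extensional: "\<chi> \<in> Irr G \<Longrightarrow> \<chi> \<in> extensional (carrier G)"
  by (auto simp: Irr_def character_of_def)

text \<open>The values of \<open>\<chi>\<close> multiply commutatively, so commutators are sent to
  \<open>1\<close>; the elements with value \<open>1\<close> form a subgroup and therefore contain
  all that the commutators generate.\<close>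

lemma (in group) linear_character_derived:
  assumes \<chi>: "\<chi> \<in> Irr G" "linear_character G \<chi>" and d: "d \<in> derived G (carrier G)"
  shows "\<chi> d = 1"
proof -
  note mult = linear_character_mult(1)[OF group_axioms \<chi>]
    and one = linear_character_mult(2)[OF group_axioms \<chi>]
  have inv: "\<chi> g * \<chi> (inv g) = 1" if "g \<in> carrier G" for g
    using mult[of g "inv g"] one that by simp
  let ?K = "{g \<in> carrier G. \<chi> g = 1}"
  have "subgroup ?K G"
  proof (rule subgroupI)
    fix a assume "a \<in> ?K"
    then show "inv a \<in> ?K" using inv[of a] by simp
  qed (use one mult in auto)
  moreover have "derived_set G (carrier G) \<subseteq> ?K"
  proof
    fix x assume "x \<in> derived_set G (carrier G)"
    then obtain g h where gh: "g \<in> carrier G" "h \<in> carrier G" "x = g \<otimes> h \<otimes> inv g \<otimes> inv h" by blast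
    then have "\<chi> x = (\<chi> g * \<chi> (inv g)) * (\<chi> h * \<chi> (inv h))" by (simp add: mult mult_ac)
    then show "x \<in> ?K" using gh inv by simp
  qed
  ultimately have "derived G (carrier G) \<subseteq> ?K"
    unfolding derived_def by (rule generate_subgroup_incl[rotated])
  with d show ?thesis by blast
qed

text \<open>A linear character is trivial on \<open>D\<close>, hence constant on its cosets, and so
  comes from a character of the quotient. Conversely the quotient is abelian, so all of its
  irreducible characters are linear and inflate to linear ones.\<close>

lemma (in group) bij_betw_inflation:
  defines "D \<equiv> derived G (carrier G)"
  shows "bij_betw (\<lambda>\<psi>. \<lambda>g\<in>carrier G. \<psi> (D #> g)) (Irr (G Mod D)) {\<chi> \<in> Irr G. linear_character G \<chi>}"
proof -
  interpret D: normal D G unfolding D_def by (rule derived_self_is_normal)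
  interpret Q: comm_group "G Mod D" unfolding D_def by (rule derived_quot_is_comm_group)
  have carr: "D #> g \<in> carrier (G Mod D)" if "g \<in> carrier G" for g
    using that by (simp add: FactGroup_def rcosetsI D.subset)
  have carrE: "\<exists>g\<in>carrier G. X = D #> g" if "X \<in> carrier (G Mod D)" for X
    using that by (auto simp: FactGroup_def RCOSETS_def)
  have mult: "(D #> g) \<otimes>\<^bsub>G Mod D\<^esub> (D #> h) = D #> (g \<otimes> h)" if "g \<in> carrier G" "h \<in> carrier G" for g h
    using that by (simp add: FactGroup_def D.rcos_sum)
  have one: "D #> \<one> = \<one>\<^bsub>G Mod D\<^esub>" by (simp add: FactGroup_def coset_mult_one D.subset)
  have linQ: "linear_character (G Mod D) \<psi>" if \<psi>: "\<psi> \<in> Irr (G Mod D)" for \<psi>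
  proof -
    obtain n \<sigma> where \<sigma>: "irreducible_representation (G Mod D) n \<sigma>" "\<psi> = character_of (G Mod D) \<sigma>"
      using \<psi> by (auto simp: Irr_def)
    then have "representation (G Mod D) 1 \<sigma>"
      using Q.irreducible_degree_one by (auto simp: irreducible_representation_def)
    then show ?thesis unfolding linear_character_def \<sigma>(2) by (rule char_degree_eq(1)[OF Q.is_group])
  qed
  show ?thesis
  proof (rule bij_betw_imageI)
    show "inj_on (\<lambda>\<psi>. \<lambda>g\<in>carrier G. \<psi> (D #> g)) (Irr (G Mod D))"
    proof (rule inj_onI)
      fix \<psi> \<psi>' assume \<psi>: "\<psi> \<in> Irr (G Mod D)" "\<psi>' \<in> Irr (G Mod D)"
        and eq: "(\<lambda>g\<in>carrier G. \<psi> (D #> g)) = (\<lambda>g\<in>carrier G. \<psi>' (D #> g))"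
      show "\<psi> = \<psi>'"
      proof (rule extensionalityI[OF Irr_extensional[OF \<psi>(1)] Irr_extensional[OF \<psi>(2)]])
        fix X assume "X \<in> carrier (G Mod D)"
        then obtain g where "g \<in> carrier G" "X = D #> g" using carrE by blast
        then show "\<psi> X = \<psi>' X" using fun_cong[OF eq, of g] by simp
      qed
    qed
    show "(\<lambda>\<psi>. \<lambda>g\<in>carrier G. \<psi> (D #> g)) ` Irr (G Mod D) = {\<chi> \<in> Irr G. linear_character G \<chi>}"
    proof (intro equalityI subsetI)
      fix \<chi> assume "\<chi> \<in> (\<lambda>\<psi>. \<lambda>g\<in>carrier G. \<psi> (D #> g)) ` Irr (G Mod D)"
      then obtain \<psi> where \<psi>: "\<psi> \<in> Irr (G Mod D)" "\<chi> = (\<lambda>g\<in>carrier G. \<psi> (D #> g))" by blast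
      note lin = linear_character_mult[OF Q.is_group \<psi>(1) linQ[OF \<psi>(1)]]
      show "\<chi> \<in> {\<chi> \<in> Irr G. linear_character G \<chi>}"
        using multiplicative_linear_character[of "\<lambda>g. \<psi> (D #> g)"] lin carr one
        by (simp add: \<psi>(2) flip: mult)
    next
      fix \<chi> assume "\<chi> \<in> {\<chi> \<in> Irr G. linear_character G \<chi>}"
      then have \<chi>: "\<chi> \<in> Irr G" "linear_character G \<chi>" by auto
      note lin = linear_character_mult[OF group_axioms \<chi>]
      \<comment> \<open>\<open>f\<close> evaluates \<open>\<chi>\<close> at an arbitrary
        representative of the coset; the choice does not matter because \<open>\<chi>\<close> is
        trivial on \<open>D\<close>.\<close>
      define f where "f X = \<chi> (SOME g. g \<in> X)" for X
      have f: "f (D #> g) = \<chi> g" if g: "g \<in> carrier G" for g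
      proof -
        have "(SOME h. h \<in> D #> g) \<in> D #> g"
          using rcos_self[OF g D.subgroup_axioms] by (rule someI)
        then obtain d where d: "d \<in> D" "(SOME h. h \<in> D #> g) = d \<otimes> g" by (auto simp: r_coset_def)
        moreover have "\<chi> d = 1" using linear_character_derived[OF \<chi>] d(1) by (simp add: D_def)
        moreover have "d \<in> carrier G" using d(1) D.subset by blast
        ultimately show ?thesis using g by (simp add: f_def lin(1))
      qed
      have "f (X \<otimes>\<^bsub>G Mod D\<^esub> Y) = f X * f Y" if XY: "X \<in> carrier (G Mod D)" "Y \<in> carrier (G Mod D)" for X Y
      proof -
        obtain g h where gh: "g \<in> carrier G" "h \<in> carrier G" "X = D #> g" "Y = D #> h"
          using carrE[OF XY(1)] carrE[OF XY(2)] by blast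
        then have "f (X \<otimes>\<^bsub>G Mod D\<^esub> Y) = \<chi> (g \<otimes> h)" by (simp only: mult f m_closed)
        then show ?thesis using gh by (simp add: f lin(1))
      qed
      moreover have "f \<one>\<^bsub>G Mod D\<^esub> = 1" using f[OF one_closed] lin(2) by (simp only: one)
      ultimately have "restrict f (carrier (G Mod D)) \<in> Irr (G Mod D)" by (rule Q.multiplicative_linear_character)
      moreover have "\<chi> = (\<lambda>g\<in>carrier G. restrict f (carrier (G Mod D)) (D #> g))"
        by (rule extensionalityI[OF Irr_extensional[OF \<chi>(1)]]) (auto simp: f carr)
      ultimately show "\<chi> \<in> (\<lambda>\<psi>. \<lambda>g\<in>carrier G. \<psi> (D #> g)) ` Irr (G Mod D)" by blast
    qed
  qed
qed

text \<open>Through inflation this is column orthogonality in the quotient by \<open>D\<close>.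
  Since the quotient is abelian, either all its elements conjugate one coset to the other or none
  does, and Lagrange's theorem gives their number.\<close>

lemma (in fin_group) linear_column_orthogonality:
  assumes x: "x \<in> carrier G" and y: "y \<in> carrier G"
  defines "D \<equiv> derived G (carrier G)"
  shows "(\<Sum>\<chi> | \<chi> \<in> Irr G \<and> linear_character G \<chi>. \<chi> x * cnj (\<chi> y))
    = (if D #> x = D #> y then of_nat (card (carrier G)) / of_nat (card D) else 0)"
proof -
  interpret D: normal D G unfolding D_def by (rule derived_self_is_normal)
  interpret Q: comm_group "G Mod D" unfolding D_def by (rule derived_quot_is_comm_group)
  have finD: "finite D" using finite_subset[OF D.subset finite_carrier] .
  interpret Q: fin_group "G Mod D"
    by unfold_locales (simp add: FactGroup_def RCOSETS_def finite_carrier)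
  have carr: "D #> g \<in> carrier (G Mod D)" if "g \<in> carrier G" for g
    using that by (simp add: FactGroup_def rcosetsI D.subset)
  have "card (rcosets D) * card D = card (carrier G)"
    using lagrange[OF D.subgroup_axioms] by (simp add: Coset.order_def)
  moreover have "card D > 0" using finD D.one_closed card_gt_0_iff by blast
  ultimately have card: "of_nat (card (carrier (G Mod D))) = (of_nat (card (carrier G)) / of_nat (card D) :: complex)"
    by (simp add: FactGroup_def field_simps flip: of_nat_mult)
  have "(\<Sum>\<chi> | \<chi> \<in> Irr G \<and> linear_character G \<chi>. \<chi> x * cnj (\<chi> y))
    = (\<Sum>\<psi>\<in>Irr (G Mod D). \<psi> (D #> x) * cnj (\<psi> (D #> y)))"
    using sum.reindex_bij_betw[OF bij_betw_inflation, of "\<lambda>\<chi>. \<chi> x * cnj (\<chi> y)"] x y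
    by (simp add: D_def)
  also have "\<dots> = of_nat (card {X \<in> carrier (G Mod D). D #> x = X \<otimes>\<^bsub>G Mod D\<^esub> (D #> y) \<otimes>\<^bsub>G Mod D\<^esub> inv\<^bsub>G Mod D\<^esub> X})"
    by (rule Q.column_orthogonality[OF carr[OF x] carr[OF y]])
  also have "{X \<in> carrier (G Mod D). D #> x = X \<otimes>\<^bsub>G Mod D\<^esub> (D #> y) \<otimes>\<^bsub>G Mod D\<^esub> inv\<^bsub>G Mod D\<^esub> X}
    = (if D #> x = D #> y then carrier (G Mod D) else {})"
  proof -
    have "X \<otimes>\<^bsub>G Mod D\<^esub> (D #> y) \<otimes>\<^bsub>G Mod D\<^esub> inv\<^bsub>G Mod D\<^esub> X = D #> y" if X: "X \<in> carrier (G Mod D)" for X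
      by (simp only: Q.m_comm[OF X carr[OF y]] Q.m_assoc[OF carr[OF y] X Q.inv_closed[OF X]]
          Q.r_inv[OF X] Q.r_one[OF carr[OF y]])
    then show ?thesis by auto
  qed
  finally show ?thesis using card by simp
qed

section \<open>Sums over conjugacy classes\<close>

context fin_group
begin

text \<open>Taken as an orbit of the very action used in \<open>conj_classes\<close>, so that the
  facts on orbits of a \<open>group_action\<close>, including orbit-stabilizer, apply.\<close>

definition conj_class :: "'a \<Rightarrow> 'a set" where
  "conj_class x = orbit G (\<lambda>g. \<lambda>h\<in>carrier G. g \<otimes> h \<otimes> inv g) x"

interpretation conj: group_action G "carrier G" "\<lambda>g. \<lambda>h\<in>carrier G. g \<otimes> h \<otimes> inv g"
  by (rule action_by_conjugation)

lemma conj_class_eq: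
  assumes "x \<in> carrier G"
  shows "conj_class x = {g \<otimes> x \<otimes> inv g | g. g \<in> carrier G}"
  using assms by (auto simp: conj_class_def orbit_def)

lemma conj_class_mem: "x \<in> carrier G \<Longrightarrow> conj_class x \<in> conj_classes G"
  by (auto simp: conj_class_def conj_classes_def orbits_def)

lemma conj_class_self: "x \<in> carrier G \<Longrightarrow> x \<in> conj_class x"
  unfolding conj_class_def by (rule conj.orbit_refl)

lemma conj_class_subset:
  assumes "x \<in> carrier G" shows "conj_class x \<subseteq> carrier G"
  using assms by (auto simp: conj_class_eq)

lemma conj_class_of_mem:
  assumes C: "C \<in> conj_classes G" and x: "x \<in> C"
  shows "conj_class x = C" "x \<in> carrier G"
proof -
  show xG: "x \<in> carrier G"
    using C x conj.orbits_coverture by (auto simp: conj_classes_def)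
  have "conj_class x \<inter> C \<noteq> {}" using conj_class_self[OF xG] x by blast
  then show "conj_class x = C"
    using conj.disjoint_union[OF conj_class_mem[OF xG, unfolded conj_classes_def] C[unfolded conj_classes_def]]
    by simp
qed

lemma conj_class_eq_iff:
  assumes "x \<in> carrier G" "y \<in> carrier G"
  shows "conj_class x = conj_class y \<longleftrightarrow> x \<in> conj_class y"
  using conj_class_of_mem(1)[OF conj_class_mem[OF assms(2)]] conj_class_self[OF assms(1)] by metis

text \<open>Each class contributes its value once for each of its elements, and the classes
  partition the group. Class-size weights thereby turn into plain sums over elements.\<close>

lemma sum_conj_classes:
  fixes F :: "'a set \<Rightarrow> real"
  shows "(\<Sum>C\<in>conj_classes G. F C * card C) = (\<Sum>x\<in>carrier G. F (conj_class x))"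
proof -
  have "(\<Sum>C\<in>conj_classes G. F C * card C) = (\<Sum>C\<in>conj_classes G. \<Sum>x\<in>C. F (conj_class x))"
  proof (rule sum.cong[OF refl])
    fix C assume C: "C \<in> conj_classes G"
    have "(\<Sum>x\<in>C. F (conj_class x)) = (\<Sum>x\<in>C. F C)"
      by (rule sum.cong[OF refl]) (simp only: conj_class_of_mem(1)[OF C])
    then show "F C * card C = (\<Sum>x\<in>C. F (conj_class x))" by simp
  qed
  also have "\<dots> = (\<Sum>x\<in>carrier G. F (conj_class x))"
    unfolding conj_classes_def by (rule conj.disjoint_sum[OF finite_carrier])
  finally show ?thesis .
qed

text \<open>For \<open>x\<close> and \<open>y\<close> in one class, both may be represented by
  \<open>y\<close>, and the count in \<open>column_orthogonality\<close> is the order of the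
  centralizer of \<open>y\<close>; orbit-stabilizer expresses it through the class size.\<close>

lemma column_orthogonality_classes:
  assumes x: "x \<in> carrier G" and y: "y \<in> carrier G"
  shows "(\<Sum>\<chi>\<in>Irr G. class_value \<chi> (conj_class x) * cnj (class_value \<chi> (conj_class y)))
    = (if conj_class x = conj_class y then of_nat (card (carrier G)) / of_nat (card (conj_class x)) else 0)"
proof -
  have cv: "class_value \<chi> (conj_class z) = \<chi> z" if "\<chi> \<in> Irr G" "z \<in> carrier G" for \<chi> z
    by (rule class_value_eq[OF group_axioms that(1) conj_class_mem[OF that(2)] conj_class_self[OF that(2)]])
  show ?thesis
  proof (cases "conj_class x = conj_class y")
    case True
    let ?S = "{g \<in> carrier G. y = g \<otimes> y \<otimes> inv g}"
    have "stabilizer G (\<lambda>g. \<lambda>h\<in>carrier G. g \<otimes> h \<otimes> inv g) y = ?S"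
      using y by (auto simp: stabilizer_def)
    then have "card (conj_class y) * card ?S = card (carrier G)"
      using conj.orbit_stabilizer_theorem[OF y] by (simp add: conj_class_def Coset.order_def)
    moreover have "card (conj_class y) > 0"
      using conj_class_self[OF y] finite_subset[OF conj_class_subset[OF y] finite_carrier]
      by (metis card_gt_0_iff empty_iff)
    ultimately have "of_nat (card ?S) = (of_nat (card (carrier G)) / of_nat (card (conj_class y)) :: complex)"
      by (simp add: field_simps flip: of_nat_mult)
    moreover have "(\<Sum>\<chi>\<in>Irr G. class_value \<chi> (conj_class y) * cnj (class_value \<chi> (conj_class y)))
      = of_nat (card ?S)"
      unfolding column_orthogonality[OF y y, symmetric] using y by (intro sum.cong) (auto simp: cv)
    ultimately show ?thesis using True by simp
  next
    case False
    then have "x \<notin> conj_class y" using conj_class_eq_iff[OF x y] by blast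
    then have empty: "{g \<in> carrier G. x = g \<otimes> y \<otimes> inv g} = {}" using y by (auto simp: conj_class_eq)
    then have "(\<Sum>\<chi>\<in>Irr G. \<chi> x * cnj (\<chi> y)) = 0"
      unfolding column_orthogonality[OF x y] empty by simp
    then show ?thesis using False x y by (simp add: cv)
  qed
qed

lemma linear_column_orthogonality_classes:
  assumes x: "x \<in> carrier G" and y: "y \<in> carrier G"
  defines "D \<equiv> derived G (carrier G)"
  shows "(\<Sum>\<chi> | \<chi> \<in> Irr G \<and> linear_character G \<chi>.
      class_value \<chi> (conj_class x) * cnj (class_value \<chi> (conj_class y)))
    = (if D #> x = D #> y then of_nat (card (carrier G)) / of_nat (card D) else 0)"
proof -
  have cv: "class_value \<chi> (conj_class z) = \<chi> z" if "\<chi> \<in> Irr G" "z \<in> carrier G" for \<chi> z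
    by (rule class_value_eq[OF group_axioms that(1) conj_class_mem[OF that(2)] conj_class_self[OF that(2)]])
  show ?thesis
    unfolding D_def linear_column_orthogonality[OF x y, symmetric]
    using x y by (intro sum.cong) (auto simp: cv)
qed

text \<open>The conjugate \<open>g \<otimes> x \<otimes> inv g\<close> is the commutator of
  \<open>g\<close> and \<open>x\<close> multiplied by \<open>x\<close>.\<close>

lemma conj_class_subset_coset:
  assumes x: "x \<in> carrier G"
  shows "conj_class x \<subseteq> derived G (carrier G) #> x"
proof
  fix y assume "y \<in> conj_class x"
  then obtain g where g: "g \<in> carrier G" "y = g \<otimes> x \<otimes> inv g" using x by (auto simp: conj_class_eq)
  have "y = (g \<otimes> x \<otimes> inv g \<otimes> inv x) \<otimes> x" using g x by (simp add: m_assoc)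
  moreover have "g \<otimes> x \<otimes> inv g \<otimes> inv x \<in> derived G (carrier G)"
    unfolding derived_def using g x by (intro generate.incl) blast
  ultimately show "y \<in> derived G (carrier G) #> x" unfolding r_coset_def by blast
qed

end

section \<open>Evaluation of the amenability constant\<close>

context fin_group
begin

text \<open>On the diagonal the weighted column sum is nonnegative because a conjugacy class lies in a
  single coset of the derived subgroup, so that its size is at most \<open>card D\<close>.\<close>

lemma cmod_weighted_column_sum:
  assumes deg: "\<And>\<chi>. \<chi> \<in> Irr G \<Longrightarrow> \<not> linear_character G \<chi> \<Longrightarrow> char_degree G \<chi> = m" and m: "m \<ge> 1"
    and x: "x \<in> carrier G" and y: "y \<in> carrier G"
  defines "D \<equiv> derived G (carrier G)" and "N \<equiv> real (card (carrier G))"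
  shows "cmod (\<Sum>\<chi>\<in>Irr G. (of_nat (char_degree G \<chi>))\<^sup>2 *
        class_value \<chi> (conj_class x) * cnj (class_value \<chi> (conj_class y)))
    = (if conj_class x = conj_class y
       then (real m)\<^sup>2 * N / card (conj_class x) - 2 * ((real m)\<^sup>2 - 1) * N / card D else 0)
      + (if D #> x = D #> y then ((real m)\<^sup>2 - 1) * N / card D else 0)"
proof -
  define v where "v \<chi> = class_value \<chi> (conj_class x) * cnj (class_value \<chi> (conj_class y))" for \<chi>
  interpret D: normal D G unfolding D_def by (rule derived_self_is_normal)
  let ?a = "if conj_class x = conj_class y then N / card (conj_class x) else 0"
  let ?b = "if D #> x = D #> y then N / card D else 0"
  \<comment> \<open>For non-linear \<open>\<chi>\<close> the weight is \<open>m\<^sup>2\<close>; for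
    linear \<open>\<chi>\<close> the subtracted term brings \<open>m\<^sup>2\<close> down to the
    weight \<open>1\<close>.\<close>
  have "(\<Sum>\<chi>\<in>Irr G. (of_nat (char_degree G \<chi>))\<^sup>2 * class_value \<chi> (conj_class x) * cnj (class_value \<chi> (conj_class y)))
    = (\<Sum>\<chi>\<in>Irr G. (of_nat m)\<^sup>2 * v \<chi> - (if linear_character G \<chi> then ((of_nat m)\<^sup>2 - 1) * v \<chi> else 0))"
    using deg by (intro sum.cong refl) (auto simp: v_def linear_character_def algebra_simps)
  also have "\<dots> = (of_nat m)\<^sup>2 * (\<Sum>\<chi>\<in>Irr G. v \<chi>)
    - ((of_nat m)\<^sup>2 - 1) * (\<Sum>\<chi> | \<chi> \<in> Irr G \<and> linear_character G \<chi>. v \<chi>)"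
    using finite_Irr by (simp add: sum_subtractf sum_distrib_left sum.If_cases Int_def)
  also have "\<dots> = of_real ((real m)\<^sup>2 * ?a - ((real m)\<^sup>2 - 1) * ?b)"
    unfolding v_def column_orthogonality_classes[OF x y] linear_column_orthogonality_classes[OF x y]
    by (simp add: D_def N_def)
  finally have norm: "cmod (\<Sum>\<chi>\<in>Irr G. (of_nat (char_degree G \<chi>))\<^sup>2 *
        class_value \<chi> (conj_class x) * cnj (class_value \<chi> (conj_class y)))
    = \<bar>(real m)\<^sup>2 * ?a - ((real m)\<^sup>2 - 1) * ?b\<bar>"
    by (simp only: norm_of_real)
  have m1: "(real m)\<^sup>2 \<ge> 1" using m by simp
  have N: "N \<ge> 0" by (simp add: N_def)
  show ?thesis
  proof (cases "conj_class x = conj_class y")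
    case True
    have fin: "finite (D #> x)"
      using finite_subset[OF r_coset_subset_G[OF D.subset x] finite_carrier] .
    have "x \<in> D #> y"
      using conj_class_self[OF x] conj_class_subset_coset[OF y] unfolding True D_def by blast
    then have coset: "D #> x = D #> y" using repr_independence[OF _ y D.subgroup_axioms] by simp
    have "card (conj_class x) \<le> card (D #> x)"
      using card_mono[OF fin] conj_class_subset_coset[OF x] by (simp add: D_def)
    also have "\<dots> = card D"
      using card_rcosets_equal[OF rcosetsI[OF D.subset x] D.subset] by simp
    finally have le: "card (conj_class x) \<le> card D" .
    have pos: "card (conj_class x) > 0"
      using conj_class_self[OF x] finite_subset[OF conj_class_subset[OF x] finite_carrier]
      by (auto simp: card_gt_0_iff)
    have "N / card D \<le> N / card (conj_class x)"
      using N le pos by (intro divide_left_mono) auto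
    then have "((real m)\<^sup>2 - 1) * (N / card D) \<le> (real m)\<^sup>2 * (N / card (conj_class x))"
      using m1 N by (intro mult_mono) auto
    then have "\<bar>(real m)\<^sup>2 * ?a - ((real m)\<^sup>2 - 1) * ?b\<bar>
      = (real m)\<^sup>2 * (N / card (conj_class x)) - ((real m)\<^sup>2 - 1) * (N / card D)"
      unfolding if_P[OF True] if_P[OF coset] by (intro abs_of_nonneg) linarith
    moreover have "(real m)\<^sup>2 * N / card (conj_class x) = (real m)\<^sup>2 * (N / card (conj_class x))"
      "2 * ((real m)\<^sup>2 - 1) * N / card D = 2 * (((real m)\<^sup>2 - 1) * (N / card D))"
      "((real m)\<^sup>2 - 1) * N / card D = ((real m)\<^sup>2 - 1) * (N / card D)"
      by simp_all
    ultimately show ?thesis unfolding norm if_P[OF True] if_P[OF coset] by linarith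
  next
    case False
    \<comment> \<open>Off the diagonal \<open>?a\<close> is zero and the absolute value makes the
      linear part positive. The statement uses this sign for all pairs in one coset, which explains
      the doubled term subtracted on the diagonal.\<close>
    then show ?thesis unfolding norm using m1 N by (simp add: abs_mult)
  qed
qed

text \<open>Applying \<open>sum_conj_classes\<close> in each of the two variables absorbs both
  class-size weights.\<close>

lemma AM_Z_eq_sum_elements:
  "AM_Z G = 1 / (real (card (carrier G)))\<^sup>2 *
     (\<Sum>x\<in>carrier G. \<Sum>y\<in>carrier G.
        cmod (\<Sum>\<chi>\<in>Irr G. (of_nat (char_degree G \<chi>))\<^sup>2 *
          class_value \<chi> (conj_class x) * cnj (class_value \<chi> (conj_class y))))"
proof -
  define S where "S C E = cmod (\<Sum>\<chi>\<in>Irr G. (of_nat (char_degree G \<chi>))\<^sup>2 *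
          class_value \<chi> C * cnj (class_value \<chi> E))" for C E
  have "(\<Sum>C\<in>conj_classes G. \<Sum>E\<in>conj_classes G. S C E * real (card C) * real (card E))
    = (\<Sum>C\<in>conj_classes G. (\<Sum>E\<in>conj_classes G. S C E * card E) * card C)"
    by (simp add: sum_distrib_left sum_distrib_right mult_ac)
  also have "\<dots> = (\<Sum>C\<in>conj_classes G. (\<Sum>y\<in>carrier G. S C (conj_class y)) * card C)"
    by (simp only: sum_conj_classes)
  also have "\<dots> = (\<Sum>x\<in>carrier G. \<Sum>y\<in>carrier G. S (conj_class x) (conj_class y))"
    by (rule sum_conj_classes)
  finally show ?thesis by (simp add: AM_Z_def S_def)
qed

lemma same_conj_class_eq:
  assumes x: "x \<in> carrier G"
  shows "{y \<in> carrier G. conj_class x = conj_class y} = conj_class x"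
  using conj_class_eq_iff[OF _ x] conj_class_subset[OF x] by auto

lemma card_same_coset:
  assumes D: "subgroup D G" and x: "x \<in> carrier G"
  shows "card {y \<in> carrier G. D #> x = D #> y} = card D"
proof -
  have sub: "D #> x \<subseteq> carrier G" using r_coset_subset_G[OF subgroup.subset[OF D] x] .
  have "{y \<in> carrier G. D #> x = D #> y} = D #> x"
    using repr_independence[OF _ x D] repr_independenceD[OF D] sub by blast
  then show ?thesis
    using card_rcosets_equal[OF rcosetsI[OF subgroup.subset[OF D] x] subgroup.subset[OF D]] by simp
qed

text \<open>The closed form of the norm is summed over \<open>y\<close>, which leaves an expression
  affine in the size of the class of \<open>x\<close>, and then over \<open>x\<close>, where the
  class sizes add up to the sum of their squares over the classes.\<close>

lemma AM_Z_two_degrees: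
  assumes deg: "\<And>\<chi>. \<chi> \<in> Irr G \<Longrightarrow> \<not> linear_character G \<chi> \<Longrightarrow> char_degree G \<chi> = m" and m: "m \<ge> 1"
  shows "AM_Z G = 1 + 2 * ((real m)\<^sup>2 - 1) *
           (1 - 1 / (real (card (carrier G)) * real (card (derived G (carrier G)))) *
                (\<Sum>C\<in>conj_classes G. (real (card C))\<^sup>2))"
proof -
  define D where "D = derived G (carrier G)"
  define N where "N = real (card (carrier G))"
  interpret D: normal D G unfolding D_def by (rule derived_self_is_normal)
  define q where "q = (real m)\<^sup>2 - 1"
  have N: "N > 0" using finite_carrier one_closed by (auto simp: N_def card_gt_0_iff)
  have "D \<noteq> {}" using D.one_closed by blast
  then have d: "card D > 0"
    using finite_subset[OF D.subset finite_carrier] by (simp add: card_gt_0_iff)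
  define s where "s = (\<Sum>C\<in>conj_classes G. (real (card C))\<^sup>2)"
  have inner: "(\<Sum>y\<in>carrier G. cmod (\<Sum>\<chi>\<in>Irr G. (of_nat (char_degree G \<chi>))\<^sup>2 *
          class_value \<chi> (conj_class x) * cnj (class_value \<chi> (conj_class y))))
      = (2 * q + 1) * N - 2 * q * N / card D * card (conj_class x)" if x: "x \<in> carrier G" for x
  proof -
    have pos: "card (conj_class x) > 0"
      using conj_class_self[OF x] finite_subset[OF conj_class_subset[OF x] finite_carrier]
      by (auto simp: card_gt_0_iff)
    have "(\<Sum>y\<in>carrier G. cmod (\<Sum>\<chi>\<in>Irr G. (of_nat (char_degree G \<chi>))\<^sup>2 *
          class_value \<chi> (conj_class x) * cnj (class_value \<chi> (conj_class y))))
      = (\<Sum>y\<in>carrier G. (if conj_class x = conj_class y then (q + 1) * N / card (conj_class x) - 2 * q * N / card D else 0)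
          + (if D #> x = D #> y then q * N / card D else 0))"
      using cmod_weighted_column_sum[OF deg m x] by (intro sum.cong) (simp_all add: D_def N_def q_def)
    \<comment> \<open>The first conditional holds for the conjugates of \<open>x\<close>, the second
      for the \<open>card D\<close> elements of its coset.\<close>
    also have "\<dots> = card (conj_class x) * ((q + 1) * N / card (conj_class x) - 2 * q * N / card D)
        + card D * (q * N / card D)"
      using finite_carrier same_conj_class_eq[OF x] card_same_coset[OF D.subgroup_axioms x]
      by (simp add: sum.distrib sum.If_cases Int_def)
    also have "\<dots> = (2 * q + 1) * N - 2 * q * N / card D * card (conj_class x)"
      using pos d by (simp add: field_simps)
    finally show ?thesis .
  qed
  have s: "(\<Sum>x\<in>carrier G. real (card (conj_class x))) = s"
    using sum_conj_classes[of "\<lambda>C. real (card C)"] by (simp add: s_def power2_eq_square)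
  have "(\<Sum>x\<in>carrier G. (2 * q + 1) * N - 2 * q * N / card D * card (conj_class x))
    = N * ((2 * q + 1) * N) - 2 * q * N / card D * s"
    unfolding s[symmetric] by (simp only: sum_subtractf sum_distrib_left sum_constant N_def)
  then have "AM_Z G = 1 / N\<^sup>2 * (N * ((2 * q + 1) * N) - 2 * q * N / card D * s)"
    unfolding AM_Z_eq_sum_elements by (simp add: inner N_def)
  also have "\<dots> = 1 + 2 * q * (1 - 1 / (N * card D) * s)"
    using N d by (simp add: field_simps power2_eq_square)
  finally show ?thesis by (simp add: N_def D_def q_def s_def)
qed

end

theorem theorem2p4:
  fixes G :: "('a, 'b) monoid_scheme" and m :: nat and \<chi> :: "'a \<Rightarrow> complex"
  assumes "group G" and "finite (carrier G)"
    and "two_character_degrees G"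
    and "\<chi> \<in> Irr G" and "\<not> linear_character G \<chi>" and "m = char_degree G \<chi>"
  shows "AM_Z G = 1 + 2 * ((real m)\<^sup>2 - 1) *
           (1 - 1 / (real (card (carrier G)) * real (card (derived G (carrier G)))) *
                (\<Sum>C\<in>conj_classes G. (real (card C))\<^sup>2))"
proof -
  interpret fin_group G using assms(1,2) by (simp add: fin_group_def fin_group_axioms_def)
  obtain n where "n > 0" "char_degree G \<chi> = n" using Irr_E[OF assms(4)] by metis
  then have "m \<ge> 1" using assms(6) by simp
  moreover have "char_degree G \<psi> = m" if "\<psi> \<in> Irr G" "\<not> linear_character G \<psi>" for \<psi>
    using assms(3-6) that unfolding two_character_degrees_def by blast
  ultimately show ?thesis by (intro AM_Z_two_degrees)
qed

end
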